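(* Let $\mu$ be a positive Borel measure on $\mathbb{C}^n$ ($n\ge 1$) such that the monomials $z^\alpha$, $\alpha\in\mathbb{N}^n$, are pairwise orthogonal in $L^2(d\mu)$ and $0<\int|z^\alpha|^2\,d\mu<\infty$ for all $\alpha\in\mathbb{N}^n$. Then the canonical solution operator $S\colon A^2_{(0,1)}(d\mu)\to L^2(d\mu)$ to $\bar\partial$ is in the Hilbert-Schmidt class if and only if $$\lim_{k\to\infty}\ \sum_{\substack{\gamma\in\mathbb{N}^n,\ |\gamma|=k\\ 1\le p\le n}}\frac{c_\gamma}{c_{\gamma+e_p}}<\infty .$$
   Context: $\mathbb{N}=\{0,1,2,\dots\}$. $A^2(d\mu)$ is the closure in $L^2(d\mu)$ of the linear span of the monomials $z^\alpha$, $\alpha\in\mathbb{N}^n$, and $c_\alpha=\left(\int|z^\alpha|^2\,d\mu\right)^{-1}$ for $\alpha\in\mathbb{N}^n$. $A^2_{(0,1)}(d\mu)$ is the Hilbert space of $(0,1)$-forms $\sum_{j=1}^n f_j\,d\bar z_j$ with $f_j\in A^2(d\mu)$, with norm squared $\sum_j\|f_j\|^2_{L^2(d\mu)}$. For $\gamma\in\mathbb{N}^n$, $|\gamma|=\gamma_1+\dots+\gamma_n$; $e_p$ is the multiindex with $1$ in position $p$ and $0$ elsewhere. Canonical solution operator: $S\omega$ is the solution $f\in L^2(d\mu)$ of $\bar\partial f=\omega$ that is orthogonal to $A^2(d\mu)$. Concretely, since $\bar\partial(\bar z_j z^\alpha)=z^\alpha d\bar z_j$, on the dense subspace of forms with polynomial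 coefficients (finite linear combinations of the $z^\alpha d\bar z_j$) $S$ is the linear map for which $S(z^\alpha d\bar z_j)$ is the unique element of $\bar z_j z^\alpha+A^2(d\mu)$ orthogonal to $A^2(d\mu)$. "$S$ is in the Hilbert-Schmidt class" means that this densely defined map extends to a Hilbert-Schmidt operator $A^2_{(0,1)}(d\mu)\to L^2(d\mu)$. "$\lim_{k\to\infty}x_k<\infty$" means that the limit exists and is finite. *)

theory Defs
  imports "HOL-Analysis.Analysis"
begin

text \<open>
  Points of complex n-space have type \<open>complex ^ 'n\<close> and multiindices have type \<open>'n \<Rightarrow> nat\<close>.
  Since the measure is a parameter, elements of \<open>L\<^sup>2\<close> are represented by functions, and all
  identities between them are required almost everywhere only.
\<close>

type_synonym 'n cfun = "complex ^ 'n \<Rightarrow> complex"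

definition L2 :: "(complex ^ 'n) measure \<Rightarrow> 'n::finite cfun set" where
  "L2 M = {f \<in> borel_measurable M. integrable M (\<lambda>z. (cmod (f z))\<^sup>2)}"

definition L2_inner :: "(complex ^ 'n) measure \<Rightarrow> 'n::finite cfun \<Rightarrow> 'n cfun \<Rightarrow> complex" where
  "L2_inner M f g = (\<integral>z. f z * cnj (g z) \<partial>M)"

definition L2_norm :: "(complex ^ 'n) measure \<Rightarrow> 'n::finite cfun \<Rightarrow> real" where
  "L2_norm M f = sqrt (\<integral>z. (cmod (f z))\<^sup>2 \<partial>M)"

definition monomial :: "('n \<Rightarrow> nat) \<Rightarrow> 'n::finite cfun" where
  "monomial \<alpha> z = (\<Prod>j\<in>UNIV. (z $ j) ^ \<alpha> j)"

definition unit_index :: "'n \<Rightarrow> 'n \<Rightarrow> nat" where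
  "unit_index p = (\<lambda>q. if q = p then 1 else 0)"

definition polynomials :: "'n::finite cfun set" where
  "polynomials = {\<lambda>z. \<Sum>\<alpha>\<in>A. a \<alpha> * monomial \<alpha> z | A a. finite A}"

definition A2 :: "(complex ^ 'n) measure \<Rightarrow> 'n::finite cfun set" where
  "A2 M = {f \<in> L2 M. \<forall>e>0. \<exists>p\<in>polynomials. L2_norm M (\<lambda>z. f z - p z) < e}"

definition mono_coeff :: "(complex ^ 'n) measure \<Rightarrow> ('n \<Rightarrow> nat) \<Rightarrow> real" where
  "mono_coeff M \<alpha> = inverse (\<integral>z. (cmod (monomial \<alpha> z))\<^sup>2 \<partial>M)" for M :: "(complex ^ 'n::finite) measure"

text \<open>
  The form \<open>\<Sum>\<^sub>j f\<^sub>j d\<zbar>\<^sub>j\<close> is represented by its coefficient family \<open>\<lambda>j. f\<^sub>j\<close>.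
\<close>

type_synonym 'n form01 = "'n \<Rightarrow> complex ^ 'n \<Rightarrow> complex"

definition A2_01 :: "(complex ^ 'n) measure \<Rightarrow> 'n::finite form01 set" where
  "A2_01 M = {F. \<forall>j. F j \<in> A2 M}"

definition form_inner :: "(complex ^ 'n) measure \<Rightarrow> 'n::finite form01 \<Rightarrow> 'n form01 \<Rightarrow> complex" where
  "form_inner M F G = (\<Sum>j\<in>UNIV. L2_inner M (F j) (G j))"

definition form_norm :: "(complex ^ 'n) measure \<Rightarrow> 'n::finite form01 \<Rightarrow> real" where
  "form_norm M F = sqrt (\<Sum>j\<in>UNIV. (L2_norm M (F j))\<^sup>2)"

definition polynomial_forms :: "'n::finite form01 set" where
  "polynomial_forms = {F. \<forall>j. F j \<in> polynomials}"

definition monomial_form :: "('n \<Rightarrow> nat) \<Rightarrow> 'n \<Rightarrow> 'n::finite form01" where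
  "monomial_form \<alpha> j = (\<lambda>i z. if i = j then monomial \<alpha> z else 0)"

definition AE_linear_on ::
    "(complex ^ 'n) measure \<Rightarrow> 'n::finite form01 set \<Rightarrow> ('n form01 \<Rightarrow> 'n cfun) \<Rightarrow> bool" where
  "AE_linear_on M D T \<longleftrightarrow>
    (\<forall>F\<in>D. \<forall>G\<in>D. \<forall>a b.
      AE z in M. T (\<lambda>j w. a * F j w + b * G j w) z = a * T F z + b * T G z)"

definition orthonormal_basis :: "(complex ^ 'n) measure \<Rightarrow> 'n::finite form01 set \<Rightarrow> bool" where
  "orthonormal_basis M E \<longleftrightarrow>
    E \<subseteq> A2_01 M \<and>
    (\<forall>F\<in>E. \<forall>G\<in>E. form_inner M F G = (if F = G then 1 else 0)) \<and>
    (\<forall>F\<in>A2_01 M. \<forall>e>0. \<exists>B a. finite B \<and> B \<subseteq> E \<and>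
      form_norm M (\<lambda>j z. F j z - (\<Sum>G\<in>B. a G * G j z)) < e)"

text \<open>
  A linear bounded operator on function representatives respects equality almost everywhere, so
  the following describes operators between the Hilbert spaces of equivalence classes.
\<close>

definition hilbert_schmidt :: "(complex ^ 'n) measure \<Rightarrow> ('n::finite form01 \<Rightarrow> 'n cfun) \<Rightarrow> bool" where
  "hilbert_schmidt M T \<longleftrightarrow>
    (\<forall>F\<in>A2_01 M. T F \<in> L2 M) \<and>
    AE_linear_on M (A2_01 M) T \<and>
    (\<exists>C. \<forall>F\<in>A2_01 M. L2_norm M (T F) \<le> C * form_norm M F) \<and>
    (\<exists>E. orthonormal_basis M E \<and> (\<lambda>F. (L2_norm M (T F))\<^sup>2) summable_on E)"

definition extends_to_hilbert_schmidt ::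
    "(complex ^ 'n) measure \<Rightarrow> ('n::finite form01 \<Rightarrow> 'n cfun) \<Rightarrow> bool" where
  "extends_to_hilbert_schmidt M S \<longleftrightarrow>
    (\<exists>T. hilbert_schmidt M T \<and> (\<forall>F\<in>polynomial_forms. AE z in M. T F z = S F z))"

definition canonical_monomial_solution ::
    "(complex ^ 'n) measure \<Rightarrow> ('n \<Rightarrow> nat) \<Rightarrow> 'n \<Rightarrow> 'n::finite cfun \<Rightarrow> bool" where
  "canonical_monomial_solution M \<alpha> j u \<longleftrightarrow>
    u \<in> L2 M \<and>
    (\<lambda>z. u z - cnj (z $ j) * monomial \<alpha> z) \<in> A2 M \<and>
    (\<forall>g\<in>A2 M. L2_inner M u g = 0)"

definition is_canonical_solution_operator ::
    "(complex ^ 'n) measure \<Rightarrow> ('n::finite form01 \<Rightarrow> 'n cfun) \<Rightarrow> bool" where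
  "is_canonical_solution_operator M S \<longleftrightarrow>
    (\<forall>F\<in>polynomial_forms. S F \<in> L2 M) \<and>
    AE_linear_on M polynomial_forms S \<and>
    (\<forall>\<alpha> j. canonical_monomial_solution M \<alpha> j (S (monomial_form \<alpha> j)))"

text \<open>
  Only the values on \<^const>\<open>polynomial_forms\<close> matter; they exist and are unique up to equality
  almost everywhere: see \<open>canonical_solution_operator_exists\<close> and
  \<open>canonical_solution_operator_unique\<close>.
\<close>

definition canonical_solution_operator ::
    "(complex ^ 'n) measure \<Rightarrow> 'n::finite form01 \<Rightarrow> 'n cfun" where
  "canonical_solution_operator M = (SOME S. is_canonical_solution_operator M S)"

context
  fixes M :: "(complex ^ 'n::finite) measure"
  assumes sets_M: "sets M = sets borel"
    and int_mono: "\<And>\<alpha>. integrable M (\<lambda>z. (cmod (monomial \<alpha> z))\<^sup>2)"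
    and pos_mono: "\<And>\<alpha>. 0 < (\<integral>z. (cmod (monomial \<alpha> z))\<^sup>2 \<partial>M)"
    and orth_mono: "\<And>\<alpha> \<beta>. \<alpha> \<noteq> \<beta> \<Longrightarrow> L2_inner M (monomial \<alpha>) (monomial \<beta>) = 0"
begin

lemma L2_meas: "f \<in> L2 M \<Longrightarrow> f \<in> borel_measurable M"
  by (simp add: L2_def)

lemma L2_int: "f \<in> L2 M \<Longrightarrow> integrable M (\<lambda>z. (cmod (f z))\<^sup>2)"
  by (simp add: L2_def)

lemma L2_mult_integrable:
  assumes "f \<in> L2 M" "g \<in> L2 M"
  shows "integrable M (\<lambda>z. f z * cnj (g z))"
proof (rule Bochner_Integration.integrable_bound)
  show "integrable M (\<lambda>z. (cmod (f z))\<^sup>2 + (cmod (g z))\<^sup>2)"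
    using assms by (intro Bochner_Integration.integrable_add L2_int)
  note [measurable] = L2_meas[OF assms(1)] L2_meas[OF assms(2)]
  have "(\<lambda>z. cnj (g z)) \<in> borel_measurable M"
    by (intro borel_measurable_continuous_on[where f = cnj] continuous_intros) measurable
  then show "(\<lambda>z. f z * cnj (g z)) \<in> borel_measurable M"
    by measurable
  have "cmod (f z * cnj (g z)) \<le> (cmod (f z))\<^sup>2 + (cmod (g z))\<^sup>2" for z
  proof -
    have "2 * (cmod (f z) * cmod (g z)) \<le> (cmod (f z))\<^sup>2 + (cmod (g z))\<^sup>2"
      using sum_squares_bound[of "cmod (f z)" "cmod (g z)"] by simp
    moreover have "0 \<le> cmod (f z) * cmod (g z)" by simp
    ultimately have "cmod (f z) * cmod (g z) \<le> (cmod (f z))\<^sup>2 + (cmod (g z))\<^sup>2" by linarith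
    then show ?thesis by (simp add: norm_mult)
  qed
  then show "AE z in M. cmod (f z * cnj (g z)) \<le> norm ((cmod (f z))\<^sup>2 + (cmod (g z))\<^sup>2)"
    by simp
qed

lemma L2_add:
  assumes "f \<in> L2 M" "g \<in> L2 M"
  shows "(\<lambda>z. f z + g z) \<in> L2 M"
proof -
  note [measurable] = L2_meas[OF assms(1)] L2_meas[OF assms(2)]
  have "integrable M (\<lambda>z. (cmod (f z + g z))\<^sup>2)"
  proof (rule Bochner_Integration.integrable_bound)
    show "integrable M (\<lambda>z. 2 * (cmod (f z))\<^sup>2 + 2 * (cmod (g z))\<^sup>2)"
      using assms by (intro Bochner_Integration.integrable_add integrable_mult_right L2_int)
    have "(cmod (f z + g z))\<^sup>2 \<le> 2 * (cmod (f z))\<^sup>2 + 2 * (cmod (g z))\<^sup>2" for z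
    proof -
      have "(cmod (f z + g z))\<^sup>2 \<le> (cmod (f z) + cmod (g z))\<^sup>2"
        by (intro power_mono norm_triangle_ineq) simp
      also have "\<dots> \<le> 2 * (cmod (f z))\<^sup>2 + 2 * (cmod (g z))\<^sup>2"
        using sum_squares_bound[of "cmod (f z)" "cmod (g z)"] by (simp add: power2_sum)
      finally show ?thesis .
    qed
    then show "AE z in M. norm ((cmod (f z + g z))\<^sup>2) \<le> norm (2 * (cmod (f z))\<^sup>2 + 2 * (cmod (g z))\<^sup>2)"
      by simp
  qed measurable
  then show ?thesis by (simp add: L2_def)
qed

lemma L2_scale:
  assumes "f \<in> L2 M"
  shows "(\<lambda>z. a * f z) \<in> L2 M"
  using assms by (auto simp: L2_def norm_mult power_mult_distrib)

lemma L2_diff: "f \<in> L2 M \<Longrightarrow> g \<in> L2 M \<Longrightarrow> (\<lambda>z. f z - g z) \<in> L2 M"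
  using L2_add[of f "\<lambda>z. (-1) * g z"] L2_scale[of g "-1"] by simp

lemma L2_zero: "(\<lambda>z. 0) \<in> L2 M"
  by (simp add: L2_def)

lemma L2_sum: "(\<And>i. i \<in> I \<Longrightarrow> f i \<in> L2 M) \<Longrightarrow> (\<lambda>z. \<Sum>i\<in>I. f i z) \<in> L2 M"
  by (induction I rule: infinite_finite_induct) (auto simp: L2_zero intro: L2_add)

lemma nth_meas: "(\<lambda>z::complex ^ 'n. z $ j) \<in> borel_measurable M"
proof -
  have "(\<lambda>z::complex ^ 'n. z $ j) \<in> borel_measurable borel"
    by (intro borel_measurable_continuous_onI continuous_intros)
  then show ?thesis using sets_M by (simp cong: measurable_cong_sets)
qed

lemma mono_meas: "monomial \<alpha> \<in> borel_measurable M"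
  using nth_meas unfolding monomial_def[abs_def] by measurable

lemma mono_L2: "monomial \<alpha> \<in> L2 M"
  using int_mono mono_meas by (simp add: L2_def)

lemma mono_add_unit: "monomial (\<lambda>q. \<alpha> q + unit_index j q) z = z $ j * monomial \<alpha> z"
proof -
  have "(\<Prod>q\<in>UNIV. (z $ q) ^ unit_index j q) = (\<Prod>q\<in>UNIV. if q = j then z $ j else 1)"
    by (intro prod.cong) (auto simp: unit_index_def)
  then show ?thesis by (simp add: monomial_def power_add prod.distrib)
qed

lemma conj_mono_L2: "(\<lambda>z. cnj (z $ j) * monomial \<alpha> z) \<in> L2 M"
proof -
  have "(\<lambda>z. cnj (z $ j)) \<in> borel_measurable M"
    using nth_meas by (intro borel_measurable_continuous_on[where f = cnj] continuous_intros)
  then have "(\<lambda>z. cnj (z $ j) * monomial \<alpha> z) \<in> borel_measurable M"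
    using mono_meas by measurable
  moreover have "(\<lambda>z. (cmod (cnj (z $ j) * monomial \<alpha> z))\<^sup>2)
      = (\<lambda>z. (cmod (monomial (\<lambda>q. \<alpha> q + unit_index j q) z))\<^sup>2)"
    by (simp add: mono_add_unit norm_mult)
  ultimately show ?thesis using int_mono by (simp add: L2_def)
qed

lemma poly_L2: "p \<in> polynomials \<Longrightarrow> p \<in> L2 M"
  unfolding polynomials_def by (auto intro!: L2_sum L2_scale mono_L2)

lemma poly_A2: "p \<in> polynomials \<Longrightarrow> p \<in> A2 M"
  using poly_L2 by (auto simp: A2_def L2_norm_def intro!: bexI[of _ p])

lemma scaled_mono_poly: "(\<lambda>z. a * monomial \<alpha> z) \<in> polynomials"
  unfolding polynomials_def
  by (rule CollectI, rule exI[of _ "{\<alpha>}"], rule exI[of _ "\<lambda>_. a"]) simp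

lemma inner_add_left:
  "f \<in> L2 M \<Longrightarrow> g \<in> L2 M \<Longrightarrow> h \<in> L2 M \<Longrightarrow>
    L2_inner M (\<lambda>z. f z + g z) h = L2_inner M f h + L2_inner M g h"
  unfolding L2_inner_def by (simp add: distrib_right L2_mult_integrable)

lemma inner_scale_left: "L2_inner M (\<lambda>z. a * f z) h = a * L2_inner M f h"
  unfolding L2_inner_def by (simp add: mult.assoc)

lemma inner_cnj: "L2_inner M f g = cnj (L2_inner M g f)"
  unfolding L2_inner_def by (simp add: mult.commute flip: Bochner_Integration.integral_cnj)

lemma inner_diff_left:
  "f \<in> L2 M \<Longrightarrow> g \<in> L2 M \<Longrightarrow> h \<in> L2 M \<Longrightarrow>
    L2_inner M (\<lambda>z. f z - g z) h = L2_inner M f h - L2_inner M g h"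
  unfolding L2_inner_def by (simp add: left_diff_distrib L2_mult_integrable)

lemma inner_diff_right:
  "f \<in> L2 M \<Longrightarrow> g \<in> L2 M \<Longrightarrow> h \<in> L2 M \<Longrightarrow>
    L2_inner M h (\<lambda>z. f z - g z) = L2_inner M h f - L2_inner M h g"
  unfolding L2_inner_def by (simp add: right_diff_distrib L2_mult_integrable)

lemma inner_sum_left:
  "(\<And>i. i \<in> I \<Longrightarrow> f i \<in> L2 M) \<Longrightarrow> h \<in> L2 M \<Longrightarrow>
    L2_inner M (\<lambda>z. \<Sum>i\<in>I. f i z) h = (\<Sum>i\<in>I. L2_inner M (f i) h)"
  unfolding L2_inner_def by (simp add: sum_distrib_right L2_mult_integrable)

lemma inner_self: "L2_inner M f f = of_real (\<integral>z. (cmod (f z))\<^sup>2 \<partial>M)"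
  unfolding L2_inner_def by (simp add: complex_norm_square[symmetric] del: of_real_power)

lemma Cauchy_Schwarz_L2:
  assumes "f \<in> L2 M" "g \<in> L2 M"
  shows "cmod (L2_inner M f g) \<le> L2_norm M f * L2_norm M g"
proof -
  have abs: "integrable M (\<lambda>z. cmod (f z) * cmod (g z))"
    using integrable_norm[OF L2_mult_integrable[OF assms]] by (simp add: norm_mult)
  define I where "I = (\<integral>z. cmod (f z) * cmod (g z) \<partial>M)"
  define F where "F = (\<integral>z. (cmod (f z))\<^sup>2 \<partial>M)"
  define G where "G = (\<integral>z. (cmod (g z))\<^sup>2 \<partial>M)"
  have nn: "0 \<le> F" "0 \<le> G" "0 \<le> I" unfolding F_def G_def I_def by simp_all
  have q: "0 \<le> s\<^sup>2 * F - 2 * s * t * I + t\<^sup>2 * G" for s t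
  proof -
    have "0 \<le> (\<integral>z. (s * cmod (f z) - t * cmod (g z))\<^sup>2 \<partial>M)" by simp
    also have "\<dots> = (\<integral>z. s\<^sup>2 * (cmod (f z))\<^sup>2 - 2 * s * t * (cmod (f z) * cmod (g z))
        + t\<^sup>2 * (cmod (g z))\<^sup>2 \<partial>M)"
      by (intro Bochner_Integration.integral_cong) (auto simp: power2_eq_square algebra_simps)
    also have "\<dots> = s\<^sup>2 * F - 2 * s * t * I + t\<^sup>2 * G"
      using abs L2_int[OF assms(1)] L2_int[OF assms(2)] unfolding F_def G_def I_def by simp
    finally show ?thesis .
  qed
  have "I\<^sup>2 \<le> F * G"
  proof (cases "G = 0")
    case True
    have "I = 0"
    proof (rule ccontr)
      assume "I \<noteq> 0"
      then have "0 \<le> F - 2 * ((F + 1) / (2 * I)) * I" using q[of 1 "(F + 1) / (2 * I)"] True by simp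
      also have "\<dots> = -1" using \<open>I \<noteq> 0\<close> by (simp add: field_simps)
      finally show False by simp
    qed
    then show ?thesis using nn by simp
  next
    case False
    have "0 \<le> G\<^sup>2 * F - 2 * G * I * I + I\<^sup>2 * G" by (rule q)
    also have "\<dots> = G * (F * G - I\<^sup>2)" by (simp add: power2_eq_square algebra_simps)
    finally show ?thesis using False nn by (simp add: zero_le_mult_iff)
  qed
  then have "I \<le> sqrt (F * G)" by (rule real_le_rsqrt)
  moreover have "cmod (L2_inner M f g) \<le> I"
    unfolding L2_inner_def I_def
    using integral_norm_bound[of M "\<lambda>z. f z * cnj (g z)"] by (simp add: norm_mult)
  ultimately show ?thesis by (simp add: L2_norm_def F_def G_def real_sqrt_mult)
qed

lemma orthogonal_A2I:
  assumes u: "u \<in> L2 M" and orth: "\<And>\<alpha>. L2_inner M u (monomial \<alpha>) = 0" and g: "g \<in> A2 M"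
  shows "L2_inner M u g = 0"
proof -
  have gL: "g \<in> L2 M" using g by (simp add: A2_def)
  have polyo: "L2_inner M p u = 0" if pp: "p \<in> polynomials" for p
  proof -
    obtain A a where p: "p = (\<lambda>z. \<Sum>\<alpha>\<in>A. a \<alpha> * monomial \<alpha> z)"
      using pp by (auto simp: polynomials_def)
    have "L2_inner M (monomial \<alpha>) u = 0" for \<alpha>
      using orth[of \<alpha>] inner_cnj[of "monomial \<alpha>" u] by simp
    then show ?thesis
      unfolding p using u by (subst inner_sum_left) (auto intro: L2_scale mono_L2 simp: inner_scale_left)
  qed
  have "cmod (L2_inner M g u) \<le> e" if "0 < e" for e
  proof -
    define d where "d = e / (L2_norm M u + 1)"
    have nu: "0 \<le> L2_norm M u" by (simp add: L2_norm_def)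
    have "0 < d" using that nu by (simp add: d_def)
    then obtain p where p: "p \<in> polynomials" "L2_norm M (\<lambda>z. g z - p z) < d"
      using g by (auto simp: A2_def)
    have "L2_inner M g u = L2_inner M (\<lambda>z. g z - p z) u"
      using polyo[OF p(1)] inner_diff_left[OF gL poly_L2[OF p(1)] u] by simp
    then have "cmod (L2_inner M g u) \<le> L2_norm M (\<lambda>z. g z - p z) * L2_norm M u"
      using Cauchy_Schwarz_L2[OF L2_diff[OF gL poly_L2[OF p(1)]] u] by simp
    also have "\<dots> \<le> d * L2_norm M u" using p(2) nu by (intro mult_right_mono) auto
    also have "\<dots> \<le> d * (L2_norm M u + 1)" using \<open>0 < d\<close> by simp
    also have "\<dots> = e" using nu by (simp add: d_def)
    finally show ?thesis .
  qed
  then have "cmod (L2_inner M g u) \<le> 0" by (rule field_le_epsilon[where y = 0, simplified])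
  then show ?thesis using inner_cnj[of u g] by simp
qed

lemma inner_mono_self:
  "L2_inner M (monomial \<alpha>) (monomial \<alpha>) = of_real (inverse (mono_coeff M \<alpha>))"
  by (simp add: inner_self mono_coeff_def)

lemma mono_coeff_pos: "0 < mono_coeff M \<alpha>"
  using pos_mono by (simp add: mono_coeff_def)

lemma canonical_monomial_solution_exists: "\<exists>u. canonical_monomial_solution M \<alpha> j u"
proof -
  define v :: "'n cfun" where "v = (\<lambda>z. cnj (z $ j) * monomial \<alpha> z)"
  have vL: "v \<in> L2 M" unfolding v_def by (rule conj_mono_L2)
  have vin: "L2_inner M v (monomial \<beta>)
      = L2_inner M (monomial \<alpha>) (monomial (\<lambda>q. \<beta> q + unit_index j q))" for \<beta>
    unfolding L2_inner_def v_def by (simp add: mono_add_unit mult_ac)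
  have "\<exists>p b. p = (\<lambda>z. b * monomial (\<alpha>(j := \<alpha> j - 1)) z) \<and>
      (\<forall>\<beta>. L2_inner M v (monomial \<beta>) = L2_inner M p (monomial \<beta>))"
  proof (cases "\<alpha> j = 0")
    case True
    have "\<alpha> \<noteq> (\<lambda>q. \<beta> q + unit_index j q)" for \<beta>
      using True by (metis add_is_0 unit_index_def zero_neq_one)
    then have "L2_inner M v (monomial \<beta>) = 0" for \<beta>
      unfolding vin by (rule orth_mono)
    then show ?thesis by (intro exI[of _ "\<lambda>z. 0"] exI[of _ 0]) (simp add: inner_scale_left[of 0, simplified])
  next
    case False
    define \<delta> where "\<delta> = \<alpha>(j := \<alpha> j - 1)"
    have \<alpha>: "\<alpha> = (\<lambda>q. \<delta> q + unit_index j q)"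
      using False by (auto simp: \<delta>_def unit_index_def)
    define b where "b = of_real (mono_coeff M \<delta>) * L2_inner M (monomial \<alpha>) (monomial \<alpha>)"
    have "L2_inner M v (monomial \<beta>) = b * L2_inner M (monomial \<delta>) (monomial \<beta>)" for \<beta>
    proof (cases "\<beta> = \<delta>")
      case True
      then show ?thesis
        using mono_coeff_pos[of \<delta>] unfolding vin b_def inner_mono_self[of \<delta>]
        by (simp add: \<alpha>[symmetric] inner_mono_self)
    next
      case False
      then have "\<alpha> \<noteq> (\<lambda>q. \<beta> q + unit_index j q)"
        unfolding \<alpha> by (metis (no_types, lifting) add_right_cancel ext)
      then show ?thesis using False unfolding vin by (simp add: orth_mono)
    qed
    then show ?thesis
      unfolding \<delta>_def[symmetric]
      by (intro exI[of _ "\<lambda>z. b * monomial \<delta> z"] exI[of _ b]) (simp add: inner_scale_left)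
  qed
  then obtain p b where p: "p = (\<lambda>z. b * monomial (\<alpha>(j := \<alpha> j - 1)) z)"
    and pin: "\<And>\<beta>. L2_inner M v (monomial \<beta>) = L2_inner M p (monomial \<beta>)" by blast
  have pL: "p \<in> L2 M" unfolding p by (intro L2_scale mono_L2)
  have "L2_inner M (\<lambda>z. v z - p z) (monomial \<beta>) = 0" for \<beta>
    using inner_diff_left[OF vL pL mono_L2] pin by simp
  then have o: "\<forall>g\<in>A2 M. L2_inner M (\<lambda>z. v z - p z) g = 0"
    using orthogonal_A2I[OF L2_diff[OF vL pL]] by blast
  have "(\<lambda>z. (v z - p z) - v z) = (\<lambda>z. (- b) * monomial (\<alpha>(j := \<alpha> j - 1)) z)"
    by (simp add: p)
  then have "(\<lambda>z. (v z - p z) - v z) \<in> A2 M"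
    using poly_A2[OF scaled_mono_poly] by metis
  then show ?thesis
    unfolding canonical_monomial_solution_def using o L2_diff[OF vL pL]
    by (intro exI[of _ "\<lambda>z. v z - p z"]) (simp add: v_def)
qed

lemma poly_coeff:
  assumes "p \<in> polynomials"
  defines "c \<equiv> \<lambda>\<alpha>. of_real (mono_coeff M \<alpha>) * L2_inner M p (monomial \<alpha>)"
  shows "finite {\<alpha>. c \<alpha> \<noteq> 0}" "p = (\<lambda>z. \<Sum>\<alpha> | c \<alpha> \<noteq> 0. c \<alpha> * monomial \<alpha> z)"
proof -
  obtain A a where A: "finite A" and p: "p = (\<lambda>z. \<Sum>\<alpha>\<in>A. a \<alpha> * monomial \<alpha> z)"
    using assms by (auto simp: polynomials_def)
  have c: "c \<beta> = (if \<beta> \<in> A then a \<beta> else 0)" for \<beta>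
  proof -
    have "L2_inner M p (monomial \<beta>) = (\<Sum>\<alpha>\<in>A. a \<alpha> * L2_inner M (monomial \<alpha>) (monomial \<beta>))"
      unfolding p by (subst inner_sum_left) (auto intro: L2_scale mono_L2 simp: inner_scale_left)
    also have "\<dots> = (\<Sum>\<alpha>\<in>A. if \<alpha> = \<beta> then a \<beta> * of_real (inverse (mono_coeff M \<beta>)) else 0)"
      by (intro sum.cong) (auto simp: orth_mono inner_mono_self)
    also have "\<dots> = (if \<beta> \<in> A then a \<beta> * of_real (inverse (mono_coeff M \<beta>)) else 0)"
      using A by simp
    finally show ?thesis using mono_coeff_pos[of \<beta>] by (simp add: c_def)
  qed
  then have sub: "{\<alpha>. c \<alpha> \<noteq> 0} \<subseteq> A" by auto
  then show "finite {\<alpha>. c \<alpha> \<noteq> 0}" using A finite_subset by blast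
  have "(\<Sum>\<alpha> | c \<alpha> \<noteq> 0. c \<alpha> * monomial \<alpha> z) = (\<Sum>\<alpha>\<in>A. c \<alpha> * monomial \<alpha> z)" for z
    using sub A by (intro sum.mono_neutral_left) auto
  also have "\<dots> z = p z" for z unfolding p by (intro sum.cong) (auto simp: c)
  finally show "p = (\<lambda>z. \<Sum>\<alpha> | c \<alpha> \<noteq> 0. c \<alpha> * monomial \<alpha> z)" by auto
qed

lemma canonical_solution_operator_exists: "\<exists>S. is_canonical_solution_operator M S"
proof -
  define s where "s = (\<lambda>\<alpha> j. SOME u. canonical_monomial_solution M \<alpha> j u)"
  have s: "canonical_monomial_solution M \<alpha> j (s \<alpha> j)" for \<alpha> j
    unfolding s_def using canonical_monomial_solution_exists by (rule someI_ex)
  define c where "c = (\<lambda>(F :: 'n form01) j \<alpha>. of_real (mono_coeff M \<alpha>) * L2_inner M (F j) (monomial \<alpha>))"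
  define S where "S = (\<lambda>F z. \<Sum>j\<in>UNIV. \<Sum>\<alpha> | c F j \<alpha> \<noteq> 0. c F j \<alpha> * s \<alpha> j z)"
  have fin: "finite {\<alpha>. c F j \<alpha> \<noteq> 0}" if "F \<in> polynomial_forms" for F j
    using poly_coeff(1)[of "F j"] that by (simp add: c_def polynomial_forms_def)
  have S1: "S F \<in> L2 M" for F
    unfolding S_def using s by (intro L2_sum L2_scale) (auto simp: canonical_monomial_solution_def)
  have lin: "S (\<lambda>j w. a * F j w + b * G j w) z = a * S F z + b * S G z"
    if F: "F \<in> polynomial_forms" and G: "G \<in> polynomial_forms" for F G a b z
  proof -
    define H where "H = (\<lambda>j w. a * F j w + b * G j w)"
    have cH: "c H j \<alpha> = a * c F j \<alpha> + b * c G j \<alpha>" for j \<alpha>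
    proof -
      have "F j \<in> L2 M" "G j \<in> L2 M" using F G poly_L2 by (auto simp: polynomial_forms_def)
      then show ?thesis
        unfolding c_def H_def
        by (subst inner_add_left) (auto intro: L2_scale mono_L2 simp: inner_scale_left algebra_simps)
    qed
    have "(\<Sum>\<alpha> | c H j \<alpha> \<noteq> 0. c H j \<alpha> * s \<alpha> j z) =
        a * (\<Sum>\<alpha> | c F j \<alpha> \<noteq> 0. c F j \<alpha> * s \<alpha> j z) + b * (\<Sum>\<alpha> | c G j \<alpha> \<noteq> 0. c G j \<alpha> * s \<alpha> j z)" for j
    proof -
      define A where "A = {\<alpha>. c F j \<alpha> \<noteq> 0} \<union> {\<alpha>. c G j \<alpha> \<noteq> 0}"
      have A: "finite A" using fin F G by (simp add: A_def)
      have e: "(\<Sum>\<alpha> | c K j \<alpha> \<noteq> 0. c K j \<alpha> * s \<alpha> j z) = (\<Sum>\<alpha>\<in>A. c K j \<alpha> * s \<alpha> j z)"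
        if "{\<alpha>. c K j \<alpha> \<noteq> 0} \<subseteq> A" for K
        using that A by (intro sum.mono_neutral_left) auto
      have "{\<alpha>. c H j \<alpha> \<noteq> 0} \<subseteq> A" "{\<alpha>. c F j \<alpha> \<noteq> 0} \<subseteq> A" "{\<alpha>. c G j \<alpha> \<noteq> 0} \<subseteq> A"
        by (auto simp: A_def cH)
      then show ?thesis
        by (simp add: e) (simp add: cH sum_distrib_left sum.distrib algebra_simps)
    qed
    then show ?thesis
      unfolding H_def[symmetric] by (simp add: S_def sum.distrib sum_distrib_left)
  qed
  have mon: "S (monomial_form \<alpha> j) = s \<alpha> j" for \<alpha> j
  proof -
    have c': "c (monomial_form \<alpha> j) i \<beta> = (if i = j \<and> \<beta> = \<alpha> then 1 else 0)" for i \<beta>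
    proof (cases "i = j")
      case True
      then show ?thesis
        using orth_mono[of \<alpha> \<beta>] mono_coeff_pos[of \<alpha>]
        by (auto simp: c_def monomial_form_def inner_mono_self)
    next
      case False
      then show ?thesis by (simp add: c_def monomial_form_def L2_inner_def)
    qed
    have "(\<Sum>\<beta> | c (monomial_form \<alpha> j) i \<beta> \<noteq> 0. c (monomial_form \<alpha> j) i \<beta> * s \<beta> i z)
        = (if i = j then s \<alpha> j z else 0)" for i z
      by (cases "i = j") (simp_all add: c')
    then show ?thesis by (simp add: S_def)
  qed
  have "is_canonical_solution_operator M S"
    unfolding is_canonical_solution_operator_def AE_linear_on_def
    using S1 s by (simp add: lin mon)
  then show ?thesis by blast
qed

lemma canonical_solution_operator_correct:
  "is_canonical_solution_operator M (canonical_solution_operator M)"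
  unfolding canonical_solution_operator_def
  using canonical_solution_operator_exists by (rule someI_ex)

lemma poly_add_scaled_mono:
  assumes "p \<in> polynomials"
  shows "(\<lambda>z. a * monomial \<alpha> z + p z) \<in> polynomials"
proof -
  obtain A b where A: "finite A" and p: "p = (\<lambda>z. \<Sum>\<beta>\<in>A. b \<beta> * monomial \<beta> z)"
    using assms by (auto simp: polynomials_def)
  define d where "d = (\<lambda>\<beta>. (if \<beta> = \<alpha> then a else 0) + (if \<beta> \<in> A then b \<beta> else 0))"
  have "(\<Sum>\<beta>\<in>insert \<alpha> A. (if \<beta> = \<alpha> then a else 0) * monomial \<beta> z) = a * monomial \<alpha> z" for z
  proof -
    have "(\<Sum>\<beta>\<in>insert \<alpha> A. (if \<beta> = \<alpha> then a else 0) * monomial \<beta> z)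
        = (\<Sum>\<beta>\<in>insert \<alpha> A. if \<beta> = \<alpha> then a * monomial \<alpha> z else 0)"
      by (intro sum.cong) auto
    then show ?thesis using A by simp
  qed
  moreover have "(\<Sum>\<beta>\<in>insert \<alpha> A. (if \<beta> \<in> A then b \<beta> else 0) * monomial \<beta> z) = p z" for z
    unfolding p using A by (intro sum.mono_neutral_cong_right) auto
  ultimately have "(\<lambda>z. a * monomial \<alpha> z + p z) = (\<lambda>z. \<Sum>\<beta>\<in>insert \<alpha> A. d \<beta> * monomial \<beta> z)"
    by (simp add: d_def distrib_right sum.distrib)
  then show ?thesis using A by (auto simp: polynomials_def)
qed

lemma canonical_monomial_solution_unique:
  assumes "canonical_monomial_solution M \<alpha> j u" "canonical_monomial_solution M \<alpha> j v"
  shows "AE z in M. u z = v z"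
proof -
  define w where "w = (\<lambda>z. u z - v z)"
  define k where "k = (\<lambda>z. cnj (z $ j) * monomial \<alpha> z)"
  have u: "u \<in> L2 M" "(\<lambda>z. u z - k z) \<in> A2 M" "\<And>g. g \<in> A2 M \<Longrightarrow> L2_inner M u g = 0"
    and v: "v \<in> L2 M" "(\<lambda>z. v z - k z) \<in> A2 M" "\<And>g. g \<in> A2 M \<Longrightarrow> L2_inner M v g = 0"
    using assms by (auto simp: canonical_monomial_solution_def k_def)
  have w: "w \<in> L2 M" unfolding w_def using u v by (intro L2_diff)
  have A2L: "g \<in> L2 M" if "g \<in> A2 M" for g using that by (simp add: A2_def)
  have wg: "L2_inner M w g = 0" if "g \<in> A2 M" for g
    using inner_diff_left[OF u(1) v(1) A2L[OF that]] u(3) v(3) that by (simp add: w_def)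
  have "L2_inner M w (\<lambda>z. (u z - k z) - (v z - k z)) = 0"
    using inner_diff_right[OF A2L[OF u(2)] A2L[OF v(2)] w] wg u(2) v(2) by simp
  then have "L2_inner M w w = 0" by (simp add: w_def)
  then have "(\<integral>z. (cmod (w z))\<^sup>2 \<partial>M) = 0" by (simp add: inner_self)
  then have "AE z in M. (cmod (w z))\<^sup>2 = 0"
    using integral_nonneg_eq_0_iff_AE[OF L2_int[OF w]] by simp
  then show ?thesis by (auto simp: w_def)
qed

lemma canonical_solution_operator_unique:
  assumes S: "is_canonical_solution_operator M S" and T: "is_canonical_solution_operator M T"
    and F: "F \<in> polynomial_forms"
  shows "AE z in M. S F z = T F z"
proof -
  define G where "G = (\<lambda>a I. (\<lambda>i z. \<Sum>(\<alpha>, j)\<in>I. a j \<alpha> * monomial_form \<alpha> j i z) :: 'n form01)"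
  have mf: "(\<lambda>i z. a * monomial_form \<alpha> j i z + H i z) \<in> polynomial_forms"
    if "H \<in> polynomial_forms" for a \<alpha> j and H :: "'n form01"
    unfolding polynomial_forms_def
  proof (rule CollectI, rule allI)
    fix i
    have "H i \<in> polynomials" using that by (simp add: polynomial_forms_def)
    then show "(\<lambda>z. a * monomial_form \<alpha> j i z + H i z) \<in> polynomials"
      using poly_add_scaled_mono by (cases "i = j") (auto simp: monomial_form_def)
  qed
  have zero: "(\<lambda>i z. 0) \<in> (polynomial_forms :: 'n form01 set)"
    using scaled_mono_poly[of 0] by (auto simp: polynomial_forms_def)
  have mono: "monomial_form \<alpha> j \<in> polynomial_forms" for \<alpha> and j :: 'n
    using mf[OF zero, of 1] by simp
  have lin: "AE z in M. R (\<lambda>j w. a * H j w + b * K j w) z = a * R H z + b * R K z"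
    if "is_canonical_solution_operator M R" "H \<in> polynomial_forms" "K \<in> polynomial_forms"
    for R a b H K
    using that unfolding is_canonical_solution_operator_def AE_linear_on_def by blast
  have G: "G a I \<in> polynomial_forms \<and> (AE z in M. S (G a I) z = T (G a I) z)" if "finite I" for a I
    using that
  proof induction
    case empty
    have "AE z in M. R (\<lambda>i z. 0) z = 0" if "is_canonical_solution_operator M R" for R
      using lin[OF that zero zero, of 0 0] by simp
    from this[OF S] this[OF T] have "AE z in M. S (\<lambda>i z. 0) z = T (\<lambda>i z. 0) z"
      by eventually_elim simp
    then show ?case using zero by (simp add: G_def)
  next
    case (insert x I)
    obtain \<alpha> j where x: "x = (\<alpha>, j)" by (cases x)
    have e: "G a (insert x I) = (\<lambda>i z. a j \<alpha> * monomial_form \<alpha> j i z + 1 * G a I i z)"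
      using insert by (simp add: G_def x)
    have "AE z in M. S (monomial_form \<alpha> j) z = T (monomial_form \<alpha> j) z"
      using S T by (intro canonical_monomial_solution_unique)
        (auto simp: is_canonical_solution_operator_def)
    then have "AE z in M. S (G a (insert x I)) z = T (G a (insert x I)) z"
      using lin[OF S mono[of \<alpha> j], of "G a I" "a j \<alpha>" 1]
        lin[OF T mono[of \<alpha> j], of "G a I" "a j \<alpha>" 1] insert.IH
      unfolding e by (auto elim: eventually_elim2)
    then show ?case using mf insert.IH unfolding e by simp
  qed
  define c where "c = (\<lambda>j \<alpha>. of_real (mono_coeff M \<alpha>) * L2_inner M (F j) (monomial \<alpha>))"
  have Fp: "F j \<in> polynomials" for j using F by (simp add: polynomial_forms_def)
  define A where "A = (\<Union>j. {\<alpha>. c j \<alpha> \<noteq> 0})"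
  have A: "finite A" using poly_coeff(1)[OF Fp] by (auto simp: A_def c_def)
  have "F i z = G c (A \<times> UNIV) i z" for i z
  proof -
    have "F i z = (\<Sum>\<alpha> | c i \<alpha> \<noteq> 0. c i \<alpha> * monomial \<alpha> z)"
      using fun_cong[OF poly_coeff(2)[OF Fp[of i]], of z] by (simp add: c_def)
    also have "\<dots> = (\<Sum>\<alpha>\<in>A. c i \<alpha> * monomial \<alpha> z)"
      using A by (intro sum.mono_neutral_left) (auto simp: A_def)
    also have "\<dots> = (\<Sum>\<alpha>\<in>A. \<Sum>j\<in>UNIV. if j = i then c i \<alpha> * monomial \<alpha> z else 0)"
      by simp
    also have "\<dots> = (\<Sum>\<alpha>\<in>A. \<Sum>j\<in>UNIV. c j \<alpha> * monomial_form \<alpha> j i z)"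
      by (intro sum.cong) (auto simp: monomial_form_def)
    finally show ?thesis by (simp add: G_def sum.cartesian_product)
  qed
  then have "F = G c (A \<times> UNIV)" by blast
  then show ?thesis using G[of "A \<times> UNIV" c] A by simp
qed

end

end

theory Submission
  imports Defs
begin

text \<open>
  The normalized monomial forms \<open>\<surd>c\<^sub>\<alpha> z\<^sup>\<alpha> d\<zbar>\<^sub>j\<close> are an orthonormal basis of the space of forms,
  so \<open>S\<close> should be Hilbert-Schmidt exactly when the squared norms of its values on them are summable.
  Those values are explicit: \<open>S(z\<^sup>\<alpha> d\<zbar>\<^sub>j)\<close> is \<open>\<zbar>\<^sub>j z\<^sup>\<alpha>\<close> minus a multiple of the monomial with
  exponent \<open>\<alpha> - e\<^sub>j\<close>. Let \<open>r(\<gamma>, p)\<close> be the quotient of the coefficients of \<open>\<gamma>\<close> and \<open>\<gamma> + e\<^sub>p\<close>;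
  then the normalized squared norm of this value is \<open>r(\<alpha>, j) - r(\<alpha> - e\<^sub>j, j)\<close>, without the second
  term if \<open>\<alpha> j = 0\<close> (\<open>solution_norm\<close>). Summed over all \<open>j\<close> and all \<open>\<alpha>\<close> of degree at most \<open>N\<close>
  this telescopes in the degree, because \<open>(\<alpha>, j) \<mapsto> (\<alpha> - e\<^sub>j, j)\<close> maps the pairs of degree \<open>k + 1\<close>
  with \<open>\<alpha> j > 0\<close> bijectively onto all pairs of degree \<open>k\<close>. The result is the sum of \<open>r(\<gamma>, p)\<close>
  over \<open>|\<gamma>| = N\<close> (\<open>sum_solution_norms\<close>). The sequence in the theorem is thus the sequence
  of partial sums of the Hilbert-Schmidt series, grouped by degree.

  It remains to justify the first sentence for operators that act on function representatives.
  If an extension of \<open>S\<close> is square summable on some orthonormal basis, it is so on every orthonormal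
  family (\<open>hilbert_schmidt_bounded_on_orthonormal\<close>): expand the family in the basis and apply Bessel's
  inequality to the values at each point \<open>z\<close> before integrating.
  Conversely, if the series of squared norms converges, the orthogonal expansion of \<open>S F\<close> converges
  absolutely at almost every point: by the inequalities of Cauchy-Schwarz and Bessel it is dominated
  there by the norm of \<open>F\<close> times the square root of an integrable function that does not depend
  on \<open>F\<close> (\<open>expansion_converges\<close>). This pointwise sum is the Hilbert-Schmidt extension
  (\<open>hilbert_schmidt_expansion\<close>, \<open>expansion_canonical\<close>).
\<close>

section \<open>The Hilbert spaces of functions and of forms\<close>

locale orthogonal_monomials =
  fixes M :: "(complex ^ 'n::finite) measure"
  assumes sets_M: "sets M = sets borel"
    and int_mono: "\<And>\<alpha>. integrable M (\<lambda>z. (cmod (monomial \<alpha> z))\<^sup>2)"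
    and pos_mono: "\<And>\<alpha>. 0 < (\<integral>z. (cmod (monomial \<alpha> z))\<^sup>2 \<partial>M)"
    and orth_mono: "\<And>\<alpha> \<beta>. \<alpha> \<noteq> \<beta> \<Longrightarrow> L2_inner M (monomial \<alpha>) (monomial \<beta>) = 0"
begin

text \<open>
  The facts about \<open>M\<close> below carry the four hypotheses as premises. Discharging the last one with
  \<open>orth_mono\<close> leaves the trivial premise \<open>\<And>\<alpha> \<beta>. \<alpha> \<noteq> \<beta> \<Longrightarrow> \<alpha> \<noteq> \<beta>\<close>, which is simplified away.
\<close>

lemmas hyps = sets_M int_mono pos_mono orth_mono
  and trivial_premise = not_False_eq_True implies_True_equals triv_forall_equality True_implies_equals

lemmas L2_meas = Defs.L2_meas[OF hyps, simplified trivial_premise]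
  and L2_int = Defs.L2_int[OF hyps, simplified trivial_premise]
  and L2_add = Defs.L2_add[OF hyps, simplified trivial_premise]
  and L2_scale = Defs.L2_scale[OF hyps, simplified trivial_premise]
  and L2_diff = Defs.L2_diff[OF hyps, simplified trivial_premise]
  and L2_sum = Defs.L2_sum[OF hyps, simplified trivial_premise]
  and mono_add_unit = Defs.mono_add_unit[OF hyps, simplified trivial_premise]
  and mono_L2 = Defs.mono_L2[OF hyps, simplified trivial_premise]
  and conj_mono_L2 = Defs.conj_mono_L2[OF hyps, simplified trivial_premise]
  and poly_A2 = Defs.poly_A2[OF hyps, simplified trivial_premise]
  and scaled_mono_poly = Defs.scaled_mono_poly[OF hyps, simplified trivial_premise]
  and poly_add_scaled_mono = Defs.poly_add_scaled_mono[OF hyps, simplified trivial_premise]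
  and mono_coeff_pos = Defs.mono_coeff_pos[OF hyps, simplified trivial_premise]
  and inner_mono_self = Defs.inner_mono_self[OF hyps, simplified trivial_premise]
  and inner_add_left = Defs.inner_add_left[OF hyps, simplified trivial_premise]
  and inner_diff_left = Defs.inner_diff_left[OF hyps, simplified trivial_premise]
  and inner_diff_right = Defs.inner_diff_right[OF hyps, simplified trivial_premise]
  and inner_scale_left = Defs.inner_scale_left[OF hyps, simplified trivial_premise]
  and inner_cnj = Defs.inner_cnj[OF hyps, simplified trivial_premise]
  and inner_sum_left = Defs.inner_sum_left[OF hyps, simplified trivial_premise]
  and inner_self = Defs.inner_self[OF hyps, simplified trivial_premise]
  and Cauchy_Schwarz_L2 = Defs.Cauchy_Schwarz_L2[OF hyps, simplified trivial_premise]
  and orthogonal_A2I = Defs.orthogonal_A2I[OF hyps, simplified trivial_premise]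
  and canonical_monomial_solution_unique = Defs.canonical_monomial_solution_unique[OF hyps, simplified trivial_premise]
  and canonical_solution_operator_correct = Defs.canonical_solution_operator_correct[OF hyps, simplified trivial_premise]
  and canonical_solution_operator_unique = Defs.canonical_solution_operator_unique[OF hyps, simplified trivial_premise]

lemma L2_norm_nonneg: "0 \<le> L2_norm M f"
  by (simp add: L2_norm_def)

lemma L2_norm_sq: "(L2_norm M f)\<^sup>2 = (\<integral>z. (cmod (f z))\<^sup>2 \<partial>M)"
  by (simp add: L2_norm_def)

lemma inner_self_norm: "L2_inner M f f = of_real ((L2_norm M f)\<^sup>2)"
  by (metis inner_self L2_norm_sq)

lemma L2_norm_scale: "L2_norm M (\<lambda>z. a * f z) = cmod a * L2_norm M f"
  by (simp add: L2_norm_def norm_mult power_mult_distrib real_sqrt_mult)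

lemma L2_norm_cong_AE:
  assumes "AE z in M. f z = g z" "f \<in> L2 M" "g \<in> L2 M"
  shows "L2_norm M f = L2_norm M g"
proof -
  note [measurable] = L2_meas[OF assms(2)] L2_meas[OF assms(3)]
  have "(\<integral>z. (cmod (f z))\<^sup>2 \<partial>M) = (\<integral>z. (cmod (g z))\<^sup>2 \<partial>M)"
    using assms(1) by (intro integral_cong_AE) auto
  then show ?thesis by (simp add: L2_norm_def)
qed

lemma inner_scale_right: "L2_inner M f (\<lambda>z. a * g z) = cnj a * L2_inner M f g"
  unfolding inner_cnj[of f] by (simp add: inner_scale_left)

lemma inner_add_right:
  assumes "f \<in> L2 M" "g \<in> L2 M" "h \<in> L2 M"
  shows "L2_inner M h (\<lambda>z. f z + g z) = L2_inner M h f + L2_inner M h g"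
  unfolding inner_cnj[of h] by (simp add: inner_add_left assms)

lemma L2_norm_triangle:
  assumes "f \<in> L2 M" "g \<in> L2 M"
  shows "L2_norm M (\<lambda>z. f z + g z) \<le> L2_norm M f + L2_norm M g"
proof (rule power2_le_imp_le)
  have "of_real ((L2_norm M (\<lambda>z. f z + g z))\<^sup>2) =
      of_real ((L2_norm M f)\<^sup>2 + (L2_norm M g)\<^sup>2) + (L2_inner M f g + cnj (L2_inner M f g))"
    using assms inner_cnj[of g f]
    by (simp add: inner_self_norm[symmetric] inner_add_left inner_add_right L2_add del: of_real_power)
  also have "\<dots> = of_real ((L2_norm M f)\<^sup>2 + (L2_norm M g)\<^sup>2 + 2 * Re (L2_inner M f g))"
    by (simp add: complex_add_cnj)
  finally have "(L2_norm M (\<lambda>z. f z + g z))\<^sup>2 =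
      (L2_norm M f)\<^sup>2 + (L2_norm M g)\<^sup>2 + 2 * Re (L2_inner M f g)"
    by (simp only: of_real_eq_iff)
  also have "Re (L2_inner M f g) \<le> L2_norm M f * L2_norm M g"
    using Cauchy_Schwarz_L2[OF assms] complex_Re_le_cmod order_trans by blast
  finally show "(L2_norm M (\<lambda>z. f z + g z))\<^sup>2 \<le> (L2_norm M f + L2_norm M g)\<^sup>2"
    by (simp add: power2_sum)
qed (simp add: L2_norm_nonneg)

lemma polynomials_lincomb:
  assumes "p \<in> polynomials" "q \<in> polynomials"
  shows "(\<lambda>z. a * p z + b * q z) \<in> polynomials"
proof -
  obtain A c where p: "finite A" "p = (\<lambda>z. \<Sum>\<alpha>\<in>A. c \<alpha> * monomial \<alpha> z)"
    using assms by (auto simp: polynomials_def)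
  obtain B d where q: "finite B" "q = (\<lambda>z. \<Sum>\<alpha>\<in>B. d \<alpha> * monomial \<alpha> z)"
    using assms by (auto simp: polynomials_def)
  have "(\<lambda>z. a * (\<Sum>\<alpha>\<in>A. c \<alpha> * monomial \<alpha> z) + b * q z) \<in> polynomials"
    using \<open>finite A\<close>
  proof induction
    case empty
    have "(\<lambda>z. b * q z) = (\<lambda>z. \<Sum>\<alpha>\<in>B. (b * d \<alpha>) * monomial \<alpha> z)"
      by (simp add: q sum_distrib_left mult.assoc)
    then show ?case using q by (auto simp: polynomials_def)
  next
    case (insert \<alpha> A)
    then show ?case
      using poly_add_scaled_mono[OF insert.IH, of "a * c \<alpha>" \<alpha>] by (simp add: algebra_simps)
  qed
  then show ?thesis by (simp add: p)
qed

lemma A2_L2: "f \<in> A2 M \<Longrightarrow> f \<in> L2 M"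
  by (simp add: A2_def)

lemma A2_lincomb:
  assumes "f \<in> A2 M" "g \<in> A2 M"
  shows "(\<lambda>z. a * f z + b * g z) \<in> A2 M"
  unfolding A2_def
proof (intro CollectI conjI allI impI)
  show "(\<lambda>z. a * f z + b * g z) \<in> L2 M"
    using assms by (intro L2_add L2_scale A2_L2)
  fix e :: real assume e: "0 < e"
  define d where "d = e / (cmod a + cmod b + 1)"
  have den: "0 < cmod a + cmod b + 1" by (simp add: add_nonneg_pos)
  have d: "0 < d" using e den by (simp add: d_def)
  obtain p where p: "p \<in> polynomials" "L2_norm M (\<lambda>z. f z - p z) < d"
    using assms(1) d by (auto simp: A2_def)
  obtain q where q: "q \<in> polynomials" "L2_norm M (\<lambda>z. g z - q z) < d"
    using assms(2) d by (auto simp: A2_def)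
  have L: "(\<lambda>z. f z - p z) \<in> L2 M" "(\<lambda>z. g z - q z) \<in> L2 M"
    using assms p q poly_A2 by (auto intro: L2_diff A2_L2)
  have "L2_norm M (\<lambda>z. a * f z + b * g z - (a * p z + b * q z)) =
      L2_norm M (\<lambda>z. a * (f z - p z) + b * (g z - q z))"
    by (simp add: algebra_simps)
  also have "\<dots> \<le> cmod a * L2_norm M (\<lambda>z. f z - p z) + cmod b * L2_norm M (\<lambda>z. g z - q z)"
    using L2_norm_triangle[OF L2_scale[OF L(1), of a] L2_scale[OF L(2), of b]]
    by (simp add: L2_norm_scale)
  also have "\<dots> \<le> cmod a * d + cmod b * d"
    using p q by (intro add_mono mult_left_mono) auto
  also have "\<dots> < (cmod a + cmod b + 1) * d" using d by (simp add: algebra_simps)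
  also have "\<dots> = e" using den by (simp add: d_def)
  finally show "\<exists>p\<in>polynomials. L2_norm M (\<lambda>z. a * f z + b * g z - p z) < e"
    by (intro bexI[of _ "\<lambda>z. a * p z + b * q z"] polynomials_lincomb p q)
qed

lemma A2_01_L2: "F \<in> A2_01 M \<Longrightarrow> F j \<in> L2 M"
  by (simp add: A2_01_def A2_L2)

lemma A2_01_lincomb:
  "F \<in> A2_01 M \<Longrightarrow> G \<in> A2_01 M \<Longrightarrow> (\<lambda>j z. a * F j z + b * G j z) \<in> A2_01 M"
  by (simp add: A2_01_def A2_lincomb)

lemma polynomial_forms_A2_01: "F \<in> polynomial_forms \<Longrightarrow> F \<in> A2_01 M"
  by (simp add: polynomial_forms_def A2_01_def poly_A2)

lemma zero_form_A2_01: "(\<lambda>j z. 0) \<in> A2_01 M"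
  using poly_A2[OF scaled_mono_poly[of 0]] by (simp add: A2_01_def)

lemma A2_01_sum:
  assumes "\<And>i. i \<in> I \<Longrightarrow> g i \<in> A2_01 M"
  shows "(\<lambda>j z. \<Sum>i\<in>I. a i * g i j z) \<in> A2_01 M"
  using assms
proof (induction I rule: infinite_finite_induct)
  case (insert i I)
  then have "(\<lambda>j z. a i * g i j z + 1 * (\<Sum>i\<in>I. a i * g i j z)) \<in> A2_01 M"
    by (intro A2_01_lincomb) auto
  then show ?case using insert by simp
qed (simp_all add: zero_form_A2_01)

lemma form_norm_nonneg: "0 \<le> form_norm M F"
  by (simp add: form_norm_def sum_nonneg)

lemma form_norm_sq: "(form_norm M F)\<^sup>2 = (\<Sum>j\<in>UNIV. (L2_norm M (F j))\<^sup>2)"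
  by (simp add: form_norm_def sum_nonneg)

lemma form_inner_self: "form_inner M F F = of_real ((form_norm M F)\<^sup>2)"
  by (simp add: form_inner_def form_norm_sq inner_self_norm)

lemma form_inner_cnj: "form_inner M F G = cnj (form_inner M G F)"
  unfolding form_inner_def cnj_sum by (intro sum.cong refl inner_cnj)

lemma form_inner_lincomb_left:
  assumes "F \<in> A2_01 M" "G \<in> A2_01 M" "H \<in> A2_01 M"
  shows "form_inner M (\<lambda>j z. a * F j z + b * G j z) H = a * form_inner M F H + b * form_inner M G H"
  using assms unfolding form_inner_def
  by (simp add: inner_add_left inner_scale_left L2_scale A2_01_L2 sum.distrib sum_distrib_left)

lemma form_inner_sum_left:
  assumes "\<And>i. i \<in> I \<Longrightarrow> g i \<in> A2_01 M" "H \<in> A2_01 M"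
  shows "form_inner M (\<lambda>j z. \<Sum>i\<in>I. a i * g i j z) H = (\<Sum>i\<in>I. a i * form_inner M (g i) H)"
proof -
  have "form_inner M (\<lambda>j z. \<Sum>i\<in>I. a i * g i j z) H =
      (\<Sum>j\<in>UNIV. \<Sum>i\<in>I. a i * L2_inner M (g i j) (H j))"
    unfolding form_inner_def
    using assms by (subst inner_sum_left) (auto intro: L2_scale A2_01_L2 simp: inner_scale_left)
  also have "\<dots> = (\<Sum>i\<in>I. a i * form_inner M (g i) H)"
    unfolding form_inner_def sum_distrib_left by (rule sum.swap)
  finally show ?thesis .
qed

lemma form_inner_sum_right:
  assumes "\<And>i. i \<in> I \<Longrightarrow> g i \<in> A2_01 M" "H \<in> A2_01 M"
  shows "form_inner M H (\<lambda>j z. \<Sum>i\<in>I. a i * g i j z) = (\<Sum>i\<in>I. cnj (a i) * form_inner M H (g i))"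
  by (subst form_inner_cnj, subst form_inner_sum_left)
    (auto simp: assms simp flip: form_inner_cnj[of H])

definition orthonormal_on :: "'i set \<Rightarrow> ('i \<Rightarrow> 'n form01) \<Rightarrow> bool" where
  "orthonormal_on I g \<longleftrightarrow> finite I \<and> (\<forall>i\<in>I. g i \<in> A2_01 M) \<and>
    (\<forall>i\<in>I. \<forall>k\<in>I. form_inner M (g i) (g k) = (if i = k then 1 else 0))"

text \<open>
  Pythagoras: among all linear combinations of an orthonormal family, the one with the Fourier
  coefficients is the best approximation, and its error decreases as the family grows. Bessel's
  inequality is the case of vanishing third summand, and \<open>F = 0\<close> gives the norm of a linear combination.
\<close>

lemma form_norm_diff_lincomb:
  assumes g: "orthonormal_on I g" and F: "F \<in> A2_01 M"
  shows "(form_norm M (\<lambda>j z. F j z - (\<Sum>i\<in>I. a i * g i j z)))\<^sup>2 =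
    (form_norm M F)\<^sup>2 - (\<Sum>i\<in>I. (cmod (form_inner M F (g i)))\<^sup>2)
      + (\<Sum>i\<in>I. (cmod (a i - form_inner M F (g i)))\<^sup>2)"
proof -
  define P where "P = (\<lambda>j z. \<Sum>i\<in>I. a i * g i j z)"
  define f where "f = (\<lambda>i. form_inner M F (g i))"
  have fin: "finite I" and gA: "\<And>i. i \<in> I \<Longrightarrow> g i \<in> A2_01 M"
    and o: "\<And>i k. i \<in> I \<Longrightarrow> k \<in> I \<Longrightarrow> form_inner M (g i) (g k) = (if i = k then 1 else 0)"
    using g by (auto simp: orthonormal_on_def)
  have PA: "P \<in> A2_01 M" unfolding P_def using gA by (rule A2_01_sum)
  define R where "R = (\<lambda>j z. 1 * F j z + (-1) * P j z)"
  have RA: "R \<in> A2_01 M" unfolding R_def using F PA by (rule A2_01_lincomb)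
  have FP: "form_inner M F P = (\<Sum>i\<in>I. cnj (a i) * f i)"
    unfolding P_def f_def by (rule form_inner_sum_right[OF gA F])
  have PF: "form_inner M P F = (\<Sum>i\<in>I. a i * cnj (f i))"
    unfolding form_inner_cnj[of P F] FP by simp
  have "form_inner M (g i) P = cnj (a i)" if "i \<in> I" for i
  proof -
    have "form_inner M (g i) P = (\<Sum>k\<in>I. if k = i then cnj (a i) else 0)"
      unfolding P_def using gA that
      by (subst form_inner_sum_right) (auto simp: o intro!: sum.cong)
    then show ?thesis using that fin by simp
  qed
  then have PP: "form_inner M P P = (\<Sum>i\<in>I. a i * cnj (a i))"
    by (subst (1) P_def, subst form_inner_sum_left[OF gA PA]) auto
  have "form_inner M R R = form_inner M F R - form_inner M P R"
    by (subst (1) R_def, subst form_inner_lincomb_left[OF F PA RA]) simp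
  also have "form_inner M F R = form_inner M F F - form_inner M F P"
    by (subst form_inner_cnj, subst R_def, subst form_inner_lincomb_left[OF F PA F])
      (simp add: form_inner_cnj[of F P] flip: form_inner_cnj[of F F])
  also have "form_inner M P R = form_inner M P F - form_inner M P P"
    by (subst form_inner_cnj, subst R_def, subst form_inner_lincomb_left[OF F PA PA])
      (simp add: form_inner_cnj[of P F] flip: form_inner_cnj[of P P])
  finally have "form_inner M R R =
      form_inner M F F + (\<Sum>i\<in>I. a i * cnj (a i) - cnj (a i) * f i - a i * cnj (f i))"
    by (simp add: FP PF PP sum_subtractf)
  also have "(\<Sum>i\<in>I. a i * cnj (a i) - cnj (a i) * f i - a i * cnj (f i)) =
      (\<Sum>i\<in>I. of_real ((cmod (a i - f i))\<^sup>2) - of_real ((cmod (f i))\<^sup>2))"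
    by (intro sum.cong refl) (simp add: complex_norm_square algebra_simps del: of_real_power)
  finally have "of_real ((form_norm M R)\<^sup>2) = (of_real
      ((form_norm M F)\<^sup>2 - (\<Sum>i\<in>I. (cmod (f i))\<^sup>2) + (\<Sum>i\<in>I. (cmod (a i - f i))\<^sup>2)) :: complex)"
    by (simp add: form_inner_self sum_subtractf del: of_real_power)
  then have "(form_norm M R)\<^sup>2 =
      (form_norm M F)\<^sup>2 - (\<Sum>i\<in>I. (cmod (f i))\<^sup>2) + (\<Sum>i\<in>I. (cmod (a i - f i))\<^sup>2)"
    by (simp only: of_real_eq_iff)
  then show ?thesis by (simp add: R_def P_def f_def)
qed

lemma Bessel:
  assumes "orthonormal_on I g" "F \<in> A2_01 M"
  shows "(\<Sum>i\<in>I. (cmod (form_inner M F (g i)))\<^sup>2) \<le> (form_norm M F)\<^sup>2"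
  using form_norm_diff_lincomb[OF assms, of "\<lambda>i. form_inner M F (g i)"]
    zero_le_power2[of "form_norm M (\<lambda>j z. F j z - (\<Sum>i\<in>I. form_inner M F (g i) * g i j z))"]
  by simp

lemma form_norm_lincomb:
  assumes "orthonormal_on I g"
  shows "(form_norm M (\<lambda>j z. \<Sum>i\<in>I. a i * g i j z))\<^sup>2 = (\<Sum>i\<in>I. (cmod (a i))\<^sup>2)"
proof -
  have "(form_norm M (\<lambda>j z. (\<Sum>i\<in>I. - a i * g i j z)))\<^sup>2 = (form_norm M (\<lambda>j z. \<Sum>i\<in>I. a i * g i j z))\<^sup>2"
    using L2_norm_scale[of "-1"] by (simp add: form_norm_sq sum_negf)
  then show ?thesis
    using form_norm_diff_lincomb[OF assms zero_form_A2_01, of a]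
    by (simp add: form_norm_def form_inner_def L2_inner_def L2_norm_def)
qed

section \<open>A Hilbert-Schmidt operator is square summable on every orthonormal family\<close>

text \<open>
  The matrix of inner products between two orthonormal families has operator norm at most 1:
  applied to \<open>y\<close>, it yields up to conjugation the Fourier coefficients, with respect to \<open>g\<close>, of a form
  of norm \<open>\<parallel>y\<parallel>\<close>.
\<close>

lemma orthonormal_contraction:
  assumes I: "orthonormal_on I g" and B: "orthonormal_on B h"
  shows "(\<Sum>i\<in>I. (cmod (\<Sum>k\<in>B. form_inner M (g i) (h k) * y k))\<^sup>2) \<le> (\<Sum>k\<in>B. (cmod (y k))\<^sup>2)"
proof -
  define v where "v = (\<lambda>j z. \<Sum>k\<in>B. cnj (y k) * h k j z)"
  have hA: "h k \<in> A2_01 M" if "k \<in> B" for k using B that by (simp add: orthonormal_on_def)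
  have gA: "g i \<in> A2_01 M" if "i \<in> I" for i using I that by (simp add: orthonormal_on_def)
  have vA: "v \<in> A2_01 M" unfolding v_def using hA by (rule A2_01_sum)
  have "form_inner M (g i) v = (\<Sum>k\<in>B. form_inner M (g i) (h k) * y k)" if "i \<in> I" for i
    unfolding v_def using hA gA[OF that] by (subst form_inner_sum_right) (auto simp: mult.commute)
  then have "(\<Sum>i\<in>I. (cmod (\<Sum>k\<in>B. form_inner M (g i) (h k) * y k))\<^sup>2) =
      (\<Sum>i\<in>I. (cmod (form_inner M v (g i)))\<^sup>2)"
    by (intro sum.cong refl) (metis form_inner_cnj complex_mod_cnj)
  also have "\<dots> \<le> (form_norm M v)\<^sup>2" by (rule Bessel[OF I vA])
  also have "\<dots> = (\<Sum>k\<in>B. (cmod (y k))\<^sup>2)" unfolding v_def form_norm_lincomb[OF B] by simp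
  finally show ?thesis .
qed

lemma AE_linear_sum:
  assumes T: "AE_linear_on M (A2_01 M) T"
    and F: "F \<in> A2_01 M" and B: "finite B" "\<And>k. k \<in> B \<Longrightarrow> h k \<in> A2_01 M"
  shows "AE z in M. T (\<lambda>j z. F j z - (\<Sum>k\<in>B. a k * h k j z)) z = T F z - (\<Sum>k\<in>B. a k * T (h k) z)"
  using B
proof induction
  case (insert k B)
  define R where "R = (\<lambda>j z. F j z - (\<Sum>k\<in>B. a k * h k j z))"
  have "(\<lambda>j z. 1 * F j z + (-1) * (\<Sum>k\<in>B. a k * h k j z)) \<in> A2_01 M"
    using F A2_01_sum[of B h a] insert.prems by (intro A2_01_lincomb) auto
  then have R: "R \<in> A2_01 M" by (simp add: R_def)
  have "AE z in M. T R z = T F z - (\<Sum>k\<in>B. a k * T (h k) z)"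
    unfolding R_def by (rule insert.IH) (simp add: insert.prems)
  moreover have "AE z in M. T (\<lambda>j z. 1 * R j z + (- a k) * h k j z) z = 1 * T R z + (- a k) * T (h k) z"
    using T R insert.prems unfolding AE_linear_on_def by blast
  moreover have "(\<lambda>j z. F j z - (\<Sum>k\<in>insert k B. a k * h k j z)) =
      (\<lambda>j z. 1 * R j z + (- a k) * h k j z)"
    using insert.hyps by (simp add: R_def algebra_simps)
  ultimately show ?case
    using insert.hyps by (auto elim!: eventually_elim2)
qed simp

text \<open>
  A contraction of scalar coefficients also contracts vector coefficients, here in \<open>L\<^sup>2\<close>: the
  inequality for scalars holds at every point and can be integrated.
\<close>

lemma L2_norm_sum_lincomb:
  assumes I: "orthonormal_on I g" and B: "orthonormal_on B h"
    and L: "\<And>k. k \<in> B \<Longrightarrow> f k \<in> L2 M"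
  shows "(\<Sum>i\<in>I. (L2_norm M (\<lambda>z. \<Sum>k\<in>B. form_inner M (g i) (h k) * f k z))\<^sup>2)
    \<le> (\<Sum>k\<in>B. (L2_norm M (f k))\<^sup>2)"
proof -
  let ?s = "\<lambda>i z. \<Sum>k\<in>B. form_inner M (g i) (h k) * f k z"
  have sL: "?s i \<in> L2 M" for i using L by (intro L2_sum L2_scale)
  have "(\<Sum>i\<in>I. (L2_norm M (?s i))\<^sup>2) = (\<integral>z. (\<Sum>i\<in>I. (cmod (?s i z))\<^sup>2) \<partial>M)"
    unfolding L2_norm_sq using L2_int[OF sL] by (subst Bochner_Integration.integral_sum) auto
  also have "\<dots> \<le> (\<integral>z. (\<Sum>k\<in>B. (cmod (f k z))\<^sup>2) \<partial>M)"
    using L2_int[OF sL] L2_int[OF L] orthonormal_contraction[OF I B]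
    by (intro integral_mono Bochner_Integration.integrable_sum) auto
  also have "\<dots> = (\<Sum>k\<in>B. (L2_norm M (f k))\<^sup>2)"
    unfolding L2_norm_sq using L2_int[OF L] by (subst Bochner_Integration.integral_sum) auto
  finally show ?thesis .
qed

text \<open>
  This crude form of the triangle inequality suffices in the next lemma, where only finiteness
  of the bound matters.
\<close>

lemma L2_norm_add_sq_le:
  assumes "f \<in> L2 M" "g \<in> L2 M"
  shows "(L2_norm M (\<lambda>z. f z + g z))\<^sup>2 \<le> 2 * (L2_norm M f)\<^sup>2 + 2 * (L2_norm M g)\<^sup>2"
proof -
  have "(L2_norm M (\<lambda>z. f z + g z))\<^sup>2 \<le> (L2_norm M f + L2_norm M g)\<^sup>2"
    using L2_norm_triangle[OF assms] by (intro power_mono L2_norm_nonneg)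
  also have "\<dots> \<le> 2 * (L2_norm M f)\<^sup>2 + 2 * (L2_norm M g)\<^sup>2"
    using sum_squares_bound[of "L2_norm M f" "L2_norm M g"] by (simp add: power2_sum)
  finally show ?thesis .
qed

text \<open>
  Replace each \<open>g i\<close> by its projection to the span of a finite part \<open>B\<close> of the basis that realizes \<open>T\<close>
  as a Hilbert-Schmidt operator. On the projections the sum is at most that over \<open>B\<close>, by contraction;
  boundedness of \<open>T\<close> makes the contribution of the remainders at most a constant, provided they are
  small compared with the size of the family.
\<close>

lemma hilbert_schmidt_bounded_on_orthonormal:
  assumes T: "hilbert_schmidt M T"
  obtains K where "\<And>(I :: 'i set) g. orthonormal_on I g \<Longrightarrow> (\<Sum>i\<in>I. (L2_norm M (T (g i)))\<^sup>2) \<le> K"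
proof -
  have TL: "T F \<in> L2 M" if "F \<in> A2_01 M" for F using T that by (simp add: hilbert_schmidt_def)
  have lin: "AE_linear_on M (A2_01 M) T" using T by (simp add: hilbert_schmidt_def)
  obtain C0 where C0: "\<And>F. F \<in> A2_01 M \<Longrightarrow> L2_norm M (T F) \<le> C0 * form_norm M F"
    using T by (auto simp: hilbert_schmidt_def)
  define C where "C = \<bar>C0\<bar> + 1"
  have C: "0 < C" by (simp add: C_def)
  have TC: "L2_norm M (T F) \<le> C * form_norm M F" if "F \<in> A2_01 M" for F
  proof -
    have "C0 * form_norm M F \<le> C * form_norm M F"
      by (intro mult_right_mono form_norm_nonneg) (simp add: C_def)
    then show ?thesis using C0[OF that] by simp
  qed
  obtain E where E: "orthonormal_basis M E" "(\<lambda>F. (L2_norm M (T F))\<^sup>2) summable_on E"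
    using T by (auto simp: hilbert_schmidt_def)
  have EA: "E \<subseteq> A2_01 M" using E(1) by (simp add: orthonormal_basis_def)
  have Eo: "orthonormal_on B (\<lambda>G. G)" if "finite B" "B \<subseteq> E" for B
    using E(1) that unfolding orthonormal_on_def orthonormal_basis_def by (simp add: subset_iff)
  define H where "H = infsum (\<lambda>F. (L2_norm M (T F))\<^sup>2) E"
  have "(\<Sum>i\<in>I. (L2_norm M (T (g i)))\<^sup>2) \<le> 2 * H + 2"
    if I: "orthonormal_on I g" for I :: "'i set" and g
  proof -
    have fin: "finite I" and gA: "\<And>i. i \<in> I \<Longrightarrow> g i \<in> A2_01 M"
      using I by (auto simp: orthonormal_on_def)
    (* chosen so that card I many remainders, each of norm at most C * e after applying T, have
       squared norms of total at most 1 *)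
    define e where "e = 1 / (C * (real (card I) + 1))"
    have e: "0 < e" using C by (simp add: e_def add_nonneg_pos)
    have "\<forall>i\<in>I. \<exists>B0 a. finite (B0) \<and> B0 \<subseteq> E \<and>
        form_norm M (\<lambda>j z. g i j z - (\<Sum>G\<in>B0. a G * G j z)) < e"
      using E(1) gA e unfolding orthonormal_basis_def by blast
    then have "\<exists>B0. \<forall>i\<in>I. \<exists>a. finite (B0 i) \<and> B0 i \<subseteq> E \<and>
        form_norm M (\<lambda>j z. g i j z - (\<Sum>G\<in>B0 i. a G * G j z)) < e"
      by (rule bchoice)
    then obtain B0 where "\<forall>i\<in>I. \<exists>a. finite (B0 i) \<and> B0 i \<subseteq> E \<and>
        form_norm M (\<lambda>j z. g i j z - (\<Sum>G\<in>B0 i. a G * G j z)) < e"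
      by (rule exE)
    then have "\<exists>a. \<forall>i\<in>I. finite (B0 i) \<and> B0 i \<subseteq> E \<and>
        form_norm M (\<lambda>j z. g i j z - (\<Sum>G\<in>B0 i. a i G * G j z)) < e"
      by (rule bchoice)
    then obtain a where B0: "\<And>i. i \<in> I \<Longrightarrow> finite (B0 i) \<and> B0 i \<subseteq> E \<and>
        form_norm M (\<lambda>j z. g i j z - (\<Sum>G\<in>B0 i. a i G * G j z)) < e"
      by blast
    define B where "B = (\<Union>i\<in>I. B0 i)"
    have B: "finite B" "B \<subseteq> E" using B0 fin by (auto simp: B_def)
    have BA: "\<And>G. G \<in> B \<Longrightarrow> G \<in> A2_01 M" using B EA by blast
    define x where "x = (\<lambda>i G. form_inner M (g i) G)"
    define R where "R = (\<lambda>i j z. g i j z - (\<Sum>G\<in>B. x i G * G j z))"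
    have RA: "R i \<in> A2_01 M" if "i \<in> I" for i
      using A2_01_lincomb[OF gA[OF that] A2_01_sum[OF BA, of B "\<lambda>G. G" "x i"], of 1 "-1"]
      by (simp add: R_def)
    have Re: "form_norm M (R i) \<le> e" if "i \<in> I" for i
    proof (rule power2_le_imp_le)
      have "(form_norm M (R i))\<^sup>2 = (form_norm M (g i))\<^sup>2 - (\<Sum>G\<in>B. (cmod (x i G))\<^sup>2)"
        unfolding R_def using form_norm_diff_lincomb[OF Eo[OF B] gA[OF that], of "x i"]
        by (simp add: x_def)
      also have "\<dots> \<le> (form_norm M (g i))\<^sup>2 - (\<Sum>G\<in>B0 i. (cmod (x i G))\<^sup>2)"
        using B that by (intro diff_left_mono sum_mono2) (auto simp: B_def)
      also have "\<dots> \<le> (form_norm M (\<lambda>j z. g i j z - (\<Sum>G\<in>B0 i. a i G * G j z)))\<^sup>2"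
        using form_norm_diff_lincomb[OF Eo gA[OF that], of "B0 i" "a i"] B0[OF that]
        by (simp add: x_def sum_nonneg)
      also have "\<dots> \<le> e\<^sup>2"
        using B0[OF that] by (intro power_mono form_norm_nonneg) auto
      finally show "(form_norm M (R i))\<^sup>2 \<le> e\<^sup>2" .
    qed (use e in simp)
    let ?s = "\<lambda>i z. \<Sum>G\<in>B. x i G * T G z"
    have sL: "?s i \<in> L2 M" for i using TL BA by (intro L2_sum L2_scale) auto
    have "(L2_norm M (T (g i)))\<^sup>2 \<le> 2 * (C * e)\<^sup>2 + 2 * (L2_norm M (?s i))\<^sup>2" if "i \<in> I" for i
    proof -
      have "AE z in M. T (R i) z = T (g i) z - ?s i z"
        unfolding R_def using AE_linear_sum[OF lin gA[OF that] B(1), of "\<lambda>G. G"] BA by auto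
      then have "AE z in M. T (g i) z = T (R i) z + ?s i z" by eventually_elim simp
      then have "(L2_norm M (T (g i)))\<^sup>2 = (L2_norm M (\<lambda>z. T (R i) z + ?s i z))\<^sup>2"
        using TL gA RA that sL by (subst L2_norm_cong_AE) (auto intro: L2_add)
      also have "\<dots> \<le> 2 * (L2_norm M (T (R i)))\<^sup>2 + 2 * (L2_norm M (?s i))\<^sup>2"
        using TL RA that sL by (intro L2_norm_add_sq_le) auto
      also have "L2_norm M (T (R i)) \<le> C * e"
        using TC[OF RA[OF that]] mult_left_mono[OF Re[OF that], of C] C by linarith
      then have "(L2_norm M (T (R i)))\<^sup>2 \<le> (C * e)\<^sup>2" by (intro power_mono L2_norm_nonneg)
      finally show ?thesis by simp
    qed
    then have "(\<Sum>i\<in>I. (L2_norm M (T (g i)))\<^sup>2) \<le>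
        (\<Sum>i\<in>I. 2 * (C * e)\<^sup>2 + 2 * (L2_norm M (?s i))\<^sup>2)"
      by (rule sum_mono)
    also have "\<dots> = 2 * (real (card I) * (C * e)\<^sup>2) + 2 * (\<Sum>i\<in>I. (L2_norm M (?s i))\<^sup>2)"
      by (simp add: sum.distrib sum_distrib_left)
    also have "(\<Sum>i\<in>I. (L2_norm M (?s i))\<^sup>2) \<le> (\<Sum>G\<in>B. (L2_norm M (T G))\<^sup>2)"
      unfolding x_def using TL BA by (intro L2_norm_sum_lincomb[OF I Eo[OF B]]) auto
    also have "(\<Sum>G\<in>B. (L2_norm M (T G))\<^sup>2) \<le> H"
      unfolding H_def using E(2) B by (intro finite_sum_le_infsum) auto
    also have "real (card I) * (C * e)\<^sup>2 \<le> 1"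
    proof -
      have "C * e = 1 / (real (card I) + 1)" using C by (simp add: e_def)
      moreover have "real (card I) \<le> (real (card I) + 1)\<^sup>2" by (simp add: power2_sum)
      ultimately show ?thesis by (simp add: power_divide divide_le_eq)
    qed
    finally show ?thesis by simp
  qed
  then show ?thesis by (rule that)
qed

section \<open>The norms of the canonical solutions and their telescoping sums\<close>

definition ratio :: "('n \<Rightarrow> nat) \<Rightarrow> 'n \<Rightarrow> real" where
  "ratio \<gamma> p = mono_coeff M \<gamma> / mono_coeff M (\<lambda>q. \<gamma> q + unit_index p q)"

definition lower :: "('n \<Rightarrow> nat) \<Rightarrow> 'n \<Rightarrow> 'n \<Rightarrow> nat" where
  "lower \<alpha> j = \<alpha>(j := \<alpha> j - 1)"

text \<open>
  The factor of the monomial to be subtracted from \<open>\<zbar>\<^sub>j z\<^sup>\<alpha>\<close>. The value 0 for \<open>\<alpha> j = 0\<close> cancels the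
  truncated subtraction in \<open>lower\<close>: in that case \<open>\<zbar>\<^sub>j z\<^sup>\<alpha>\<close> is itself orthogonal to all monomials.
\<close>

definition lower_ratio :: "('n \<Rightarrow> nat) \<Rightarrow> 'n \<Rightarrow> real" where
  "lower_ratio \<alpha> j = (if \<alpha> j = 0 then 0 else ratio (lower \<alpha> j) j)"

definition solution :: "('n \<Rightarrow> nat) \<Rightarrow> 'n \<Rightarrow> 'n cfun" where
  "solution \<alpha> j z =
    cnj (z $ j) * monomial \<alpha> z - of_real (lower_ratio \<alpha> j) * monomial (lower \<alpha> j) z"

lemma lower_add_unit: "\<alpha> j \<noteq> 0 \<Longrightarrow> (\<lambda>q. lower \<alpha> j q + unit_index j q) = \<alpha>"
  by (auto simp: lower_def unit_index_def)

lemma add_unit_lower: "lower (\<lambda>q. \<gamma> q + unit_index j q) j = \<gamma>"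
  by (auto simp: lower_def unit_index_def)

lemma inner_mono: "L2_inner M (monomial \<alpha>) (monomial \<beta>) =
    (if \<alpha> = \<beta> then of_real (inverse (mono_coeff M \<alpha>)) else 0)"
  by (simp add: inner_mono_self orth_mono)

text \<open>
  Moving \<open>\<zbar>\<^sub>j\<close> to the other side of the inner product turns it into multiplication of \<open>z\<^sup>\<beta>\<close> by \<open>z\<^sub>j\<close>, so
  \<open>\<zbar>\<^sub>j z\<^sup>\<alpha>\<close> sees only the monomial with exponent \<open>\<alpha> - e\<^sub>j\<close>. The right-hand side is therefore the inner
  product with its projection to the holomorphic part.
\<close>

lemma inner_conj_mono:
  "L2_inner M (\<lambda>z. cnj (z $ j) * monomial \<alpha> z) (monomial \<beta>) =
    of_real (lower_ratio \<alpha> j) * L2_inner M (monomial (lower \<alpha> j)) (monomial \<beta>)"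
proof -
  let ?up = "\<lambda>q. \<beta> q + unit_index j q"
  have "L2_inner M (\<lambda>z. cnj (z $ j) * monomial \<alpha> z) (monomial \<beta>) =
      L2_inner M (monomial \<alpha>) (monomial ?up)"
    unfolding L2_inner_def by (simp add: mono_add_unit mult_ac)
  also have "\<dots> = of_real (lower_ratio \<alpha> j) * L2_inner M (monomial (lower \<alpha> j)) (monomial \<beta>)"
  proof (cases "\<alpha> j = 0")
    case True
    then have "\<alpha> \<noteq> ?up" by (auto simp: unit_index_def fun_eq_iff)
    then show ?thesis using True by (simp add: orth_mono lower_ratio_def)
  next
    case False
    have "\<alpha> = ?up \<longleftrightarrow> lower \<alpha> j = \<beta>"
      using lower_add_unit[of \<alpha> j, OF False] add_unit_lower[of \<beta> j] by metis
    moreover have "mono_coeff M \<alpha> \<noteq> 0" "mono_coeff M (lower \<alpha> j) \<noteq> 0"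
      using mono_coeff_pos less_irrefl by metis+
    ultimately show ?thesis
      using False by (auto simp: inner_mono lower_ratio_def ratio_def lower_add_unit field_simps)
  qed
  finally show ?thesis .
qed

lemma solution_canonical: "canonical_monomial_solution M \<alpha> j (solution \<alpha> j)"
proof -
  have L: "solution \<alpha> j \<in> L2 M"
    unfolding solution_def[abs_def] by (intro L2_diff L2_scale conj_mono_L2 mono_L2)
  have "L2_inner M (solution \<alpha> j) (monomial \<beta>) = 0" for \<beta>
    unfolding solution_def[abs_def]
    by (simp add: inner_diff_left L2_scale conj_mono_L2 mono_L2 inner_scale_left inner_conj_mono)
  then have "\<forall>g\<in>A2 M. L2_inner M (solution \<alpha> j) g = 0"
    using orthogonal_A2I[OF L] by blast
  moreover have "(\<lambda>z. solution \<alpha> j z - cnj (z $ j) * monomial \<alpha> z) =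
      (\<lambda>z. of_real (- lower_ratio \<alpha> j) * monomial (lower \<alpha> j) z)"
    by (simp add: solution_def)
  ultimately show ?thesis
    unfolding canonical_monomial_solution_def
    using L poly_A2[OF scaled_mono_poly, of "of_real (- lower_ratio \<alpha> j)" "lower \<alpha> j"] by simp
qed

lemma solution_L2: "solution \<alpha> j \<in> L2 M"
  using solution_canonical by (simp add: canonical_monomial_solution_def)

text \<open>
  With \<open>v = \<zbar>\<^sub>j z\<^sup>\<alpha>\<close> and \<open>p\<close> its projection, \<open>\<parallel>v - p\<parallel>\<^sup>2 = \<langle>v, v\<rangle> - \<langle>p, v\<rangle>\<close> because \<open>v - p\<close> is orthogonal
  to \<open>p\<close>; both terms are squared norms of monomials.
\<close>

lemma solution_norm:
  "mono_coeff M \<alpha> * (L2_norm M (solution \<alpha> j))\<^sup>2 = ratio \<alpha> j - lower_ratio \<alpha> j"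
proof -
  define v where "v = (\<lambda>z. cnj (z $ j) * monomial \<alpha> z)"
  define p where "p = (\<lambda>z. of_real (lower_ratio \<alpha> j) * monomial (lower \<alpha> j) z)"
  have vL: "v \<in> L2 M" and pL: "p \<in> L2 M"
    unfolding v_def p_def by (intro conj_mono_L2 L2_scale mono_L2)+
  have s: "solution \<alpha> j = (\<lambda>z. v z - p z)" by (simp add: solution_def[abs_def] v_def p_def)
  have pA: "p \<in> A2 M" unfolding p_def by (intro poly_A2 scaled_mono_poly)
  have "L2_inner M (solution \<alpha> j) (solution \<alpha> j) = L2_inner M (solution \<alpha> j) v - L2_inner M (solution \<alpha> j) p"
    by (subst (2) s) (rule inner_diff_right[OF vL pL solution_L2])
  also have "L2_inner M (solution \<alpha> j) p = 0"
    using solution_canonical pA by (simp add: canonical_monomial_solution_def)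
  also have "L2_inner M (solution \<alpha> j) v = L2_inner M v v - L2_inner M p v"
    unfolding s by (rule inner_diff_left[OF vL pL vL])
  also have "L2_inner M v v =
      L2_inner M (monomial (\<lambda>q. \<alpha> q + unit_index j q)) (monomial (\<lambda>q. \<alpha> q + unit_index j q))"
    unfolding L2_inner_def v_def by (simp add: mono_add_unit mult_ac)
  also have "\<dots> = of_real (ratio \<alpha> j / mono_coeff M \<alpha>)"
    using mono_coeff_pos[of \<alpha>] by (simp add: inner_mono ratio_def inverse_eq_divide)
  also have "L2_inner M p v = of_real (lower_ratio \<alpha> j) *
      L2_inner M (monomial (\<lambda>q. lower \<alpha> j q + unit_index j q)) (monomial \<alpha>)"
    unfolding p_def v_def inner_scale_left by (simp add: L2_inner_def mono_add_unit mult_ac)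
  also have "\<dots> = of_real (lower_ratio \<alpha> j / mono_coeff M \<alpha>)"
    by (cases "\<alpha> j = 0") (simp_all add: lower_ratio_def lower_add_unit inner_mono divide_inverse)
  finally have "(of_real ((L2_norm M (solution \<alpha> j))\<^sup>2) :: complex) =
      of_real ((ratio \<alpha> j - lower_ratio \<alpha> j) / mono_coeff M \<alpha>)"
    by (simp add: inner_self_norm diff_divide_distrib del: of_real_power)
  then have "(L2_norm M (solution \<alpha> j))\<^sup>2 = (ratio \<alpha> j - lower_ratio \<alpha> j) / mono_coeff M \<alpha>"
    by (simp only: of_real_eq_iff)
  then show ?thesis using mono_coeff_pos[of \<alpha>] by simp
qed

definition graded :: "nat \<Rightarrow> (('n \<Rightarrow> nat) \<times> 'n) set" where
  "graded k = {\<gamma>. (\<Sum>j\<in>UNIV. \<gamma> j) = k} \<times> UNIV"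

lemma finite_graded: "finite (graded k)"
proof -
  have "{\<gamma> :: 'n \<Rightarrow> nat. (\<Sum>j\<in>UNIV. \<gamma> j) = k} \<subseteq> (UNIV :: 'n set) \<rightarrow>\<^sub>E {..k}"
    by (auto intro: member_le_sum)
  moreover have "finite ((UNIV :: 'n set) \<rightarrow>\<^sub>E {..k})" by (intro finite_PiE) auto
  ultimately have "finite {\<gamma> :: 'n \<Rightarrow> nat. (\<Sum>j\<in>UNIV. \<gamma> j) = k}" by (rule finite_subset)
  then show ?thesis by (simp add: graded_def)
qed

lemma graded_disjoint: "k \<noteq> l \<Longrightarrow> graded k \<inter> graded l = {}"
  by (auto simp: graded_def)

lemma sum_lower_ratio_0: "(\<Sum>(\<alpha>, j)\<in>graded 0. lower_ratio \<alpha> j) = 0"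
  by (intro sum.neutral) (auto simp: graded_def lower_ratio_def)

text \<open>
  The pairs \<open>(\<alpha>, j)\<close> of degree \<open>k + 1\<close> with \<open>\<alpha> j > 0\<close> are exactly the \<open>(\<gamma> + e\<^sub>p, p)\<close> with \<open>(\<gamma>, p)\<close> of
  degree \<open>k\<close>. This is the reason for the telescoping.
\<close>

lemma sum_lower_ratio_Suc:
  "(\<Sum>(\<alpha>, j)\<in>graded (Suc k). lower_ratio \<alpha> j) = (\<Sum>(\<gamma>, p)\<in>graded k. ratio \<gamma> p)"
proof -
  let ?pos = "{(\<alpha>, j) \<in> graded (Suc k). \<alpha> j \<noteq> 0}"
  have deg: "(\<Sum>q\<in>UNIV. \<gamma> q + unit_index p q) = Suc (\<Sum>q\<in>UNIV. \<gamma> q)" for \<gamma> and p :: 'n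
    by (simp add: sum.distrib unit_index_def)
  have deg': "Suc (\<Sum>q\<in>UNIV. lower \<alpha> j q) = (\<Sum>q\<in>UNIV. \<alpha> q)" if "\<alpha> j \<noteq> 0" for \<alpha> and j :: 'n
    using deg[of "lower \<alpha> j" j] unfolding lower_add_unit[of \<alpha> j, OF that] by simp
  have "(\<Sum>(\<alpha>, j)\<in>graded (Suc k). lower_ratio \<alpha> j) = (\<Sum>(\<alpha>, j)\<in>?pos. lower_ratio \<alpha> j)"
    using finite_graded by (intro sum.mono_neutral_right) (auto simp: lower_ratio_def split: if_splits)
  also have "\<dots> = (\<Sum>(\<gamma>, p)\<in>graded k. ratio \<gamma> p)"
  proof (rule sum.reindex_bij_witness[where
          i = "\<lambda>(\<gamma>, p). (\<lambda>q. \<gamma> q + unit_index p q, p)" and j = "\<lambda>(\<alpha>, j). (lower \<alpha> j, j)"])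
    have "unit_index p p = 1" for p :: 'n by (simp add: unit_index_def)
    then show "(case x of (\<gamma>, p) \<Rightarrow> (\<lambda>q. \<gamma> q + unit_index p q, p)) \<in> ?pos" if "x \<in> graded k" for x
      using that by (auto simp: graded_def deg)
    show "(case x of (\<alpha>, j) \<Rightarrow> (lower \<alpha> j, j)) \<in> graded k" if "x \<in> ?pos" for x
    proof -
      obtain \<alpha> j where x: "x = (\<alpha>, j)" by (cases x)
      show ?thesis using that deg'[of \<alpha> j] by (simp add: x graded_def)
    qed
  qed (auto simp: lower_add_unit add_unit_lower lower_ratio_def)
  finally show ?thesis .
qed

lemma sum_solution_norms:
  "(\<Sum>k\<le>N. \<Sum>(\<alpha>, j)\<in>graded k. mono_coeff M \<alpha> * (L2_norm M (solution \<alpha> j))\<^sup>2) =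
    (\<Sum>(\<gamma>, p)\<in>graded N. ratio \<gamma> p)"
proof (induction N)
  case 0
  then show ?case
    using sum_lower_ratio_0 by (simp add: solution_norm case_prod_unfold sum_subtractf)
next
  case (Suc N)
  then show ?case
    using sum_lower_ratio_Suc[of N] by (simp add: solution_norm case_prod_unfold sum_subtractf)
qed

section \<open>The orthonormal basis of normalized monomial forms\<close>

definition basis_form :: "('n \<Rightarrow> nat) \<times> 'n \<Rightarrow> 'n form01" where
  "basis_form = (\<lambda>(\<alpha>, j) i z. of_real (sqrt (mono_coeff M \<alpha>)) * monomial_form \<alpha> j i z)"

definition basis_solution :: "('n \<Rightarrow> nat) \<times> 'n \<Rightarrow> 'n cfun" where
  "basis_solution = (\<lambda>(\<alpha>, j) z. of_real (sqrt (mono_coeff M \<alpha>)) * solution \<alpha> j z)"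

lemma basis_form_apply: "basis_form (\<alpha>, j) i =
    (if i = j then (\<lambda>z. of_real (sqrt (mono_coeff M \<alpha>)) * monomial \<alpha> z) else (\<lambda>z. 0))"
  by (auto simp: basis_form_def monomial_form_def)

lemma scaled_monomial_form_polynomial: "(\<lambda>i z. a * monomial_form \<alpha> j i z) \<in> polynomial_forms"
  unfolding polynomial_forms_def
proof (intro CollectI allI)
  fix i
  show "(\<lambda>z. a * monomial_form \<alpha> j i z) \<in> polynomials"
    using scaled_mono_poly[of a \<alpha>] scaled_mono_poly[of 0 \<alpha>]
    by (cases "i = j") (simp_all add: monomial_form_def)
qed

lemma basis_form_polynomial: "basis_form x \<in> polynomial_forms"
  by (auto simp: basis_form_def scaled_monomial_form_polynomial split: prod.split)

lemma basis_form_A2_01: "basis_form x \<in> A2_01 M"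
  by (intro polynomial_forms_A2_01 basis_form_polynomial)

lemma form_inner_basis_form:
  "form_inner M F (basis_form (\<alpha>, j)) =
    of_real (sqrt (mono_coeff M \<alpha>)) * L2_inner M (F j) (monomial \<alpha>)"
proof -
  have "L2_inner M f (\<lambda>z. 0) = 0" for f by (simp add: L2_inner_def)
  then have "form_inner M F (basis_form (\<alpha>, j)) =
      (\<Sum>i\<in>UNIV. if i = j then of_real (sqrt (mono_coeff M \<alpha>)) * L2_inner M (F j) (monomial \<alpha>) else 0)"
    unfolding form_inner_def by (intro sum.cong) (auto simp: basis_form_apply inner_scale_right)
  then show ?thesis by simp
qed

lemma basis_form_inner: "form_inner M (basis_form x) (basis_form y) = (if x = y then 1 else 0)"
proof -
  obtain \<alpha> j \<beta> i where x: "x = (\<alpha>, j)" and y: "y = (\<beta>, i)" by (cases x, cases y)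
  have c: "complex_of_real (sqrt (mono_coeff M \<alpha>)) *
      (of_real (sqrt (mono_coeff M \<alpha>)) * of_real (inverse (mono_coeff M \<alpha>))) = 1"
    using mono_coeff_pos[of \<alpha>] by (simp flip: of_real_mult of_real_inverse mult.assoc)
  have "L2_inner M (\<lambda>z. 0) f = 0" for f by (simp add: L2_inner_def)
  then show ?thesis
    using c unfolding x y form_inner_basis_form basis_form_apply
    by (auto simp: inner_scale_left inner_mono simp del: of_real_inverse)
qed

lemma basis_form_orthonormal: "finite I \<Longrightarrow> orthonormal_on I basis_form"
  by (simp add: orthonormal_on_def basis_form_A2_01 basis_form_inner)

lemma inj_basis_form: "inj basis_form"
  using basis_form_inner by (metis injI zero_neq_one)

text \<open>
  A form is approximated one component at a time, by polynomials, within an equal share of the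
  error for each of the components.
\<close>

lemma basis_form_dense:
  assumes F: "F \<in> A2_01 M" and e: "0 < e"
  shows "\<exists>I a. finite I \<and> form_norm M (\<lambda>j z. F j z - (\<Sum>x\<in>I. a x * basis_form x j z)) < e"
proof -
  define d where "d = e / real CARD('n)"
  have d: "0 < d" using e by (simp add: d_def)
  have "\<exists>p\<in>polynomials. L2_norm M (\<lambda>z. F j z - p z) < d" for j
    using F d by (auto simp: A2_01_def A2_def)
  then have "\<forall>j. \<exists>A b. finite A \<and> L2_norm M (\<lambda>z. F j z - (\<Sum>\<alpha>\<in>A. b \<alpha> * monomial \<alpha> z)) < d"
    unfolding polynomials_def by blast
  then have "\<exists>A. \<forall>j. \<exists>b. finite (A j) \<and> L2_norm M (\<lambda>z. F j z - (\<Sum>\<alpha>\<in>A j. b \<alpha> * monomial \<alpha> z)) < d"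
    by (rule choice)
  then obtain A where "\<forall>j. \<exists>b. finite (A j) \<and> L2_norm M (\<lambda>z. F j z - (\<Sum>\<alpha>\<in>A j. b \<alpha> * monomial \<alpha> z)) < d"
    by (rule exE)
  then have "\<exists>b. \<forall>j. finite (A j) \<and> L2_norm M (\<lambda>z. F j z - (\<Sum>\<alpha>\<in>A j. b j \<alpha> * monomial \<alpha> z)) < d"
    by (rule choice)
  then obtain b where "\<forall>j. finite (A j) \<and> L2_norm M (\<lambda>z. F j z - (\<Sum>\<alpha>\<in>A j. b j \<alpha> * monomial \<alpha> z)) < d"
    by (rule exE)
  then have A: "\<And>j. finite (A j)"
    and b: "\<And>j. L2_norm M (\<lambda>z. F j z - (\<Sum>\<alpha>\<in>A j. b j \<alpha> * monomial \<alpha> z)) < d"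
    by simp_all
  (* common exponents for all components; a vanishes where an exponent is not used *)
  define I where "I = (\<Union>j. A j) \<times> (UNIV :: 'n set)"
  define a where "a = (\<lambda>(\<alpha>, j). if \<alpha> \<in> A j then b j \<alpha> / of_real (sqrt (mono_coeff M \<alpha>)) else 0)"
  have I: "finite I" using A by (simp add: I_def)
  have "(\<Sum>x\<in>I. a x * basis_form x j z) = (\<Sum>\<alpha>\<in>A j. b j \<alpha> * monomial \<alpha> z)" for j z
  proof -
    have "(\<Sum>x\<in>I. a x * basis_form x j z) =
        (\<Sum>\<alpha>\<in>(\<Union>j. A j). \<Sum>i\<in>UNIV. a (\<alpha>, i) * basis_form (\<alpha>, i) j z)"
      unfolding I_def by (simp add: sum.cartesian_product)
    also have "\<dots> = (\<Sum>\<alpha>\<in>(\<Union>j. A j). \<Sum>i\<in>UNIV. if i = j then (if \<alpha> \<in> A j then b j \<alpha> * monomial \<alpha> z else 0) else 0)"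
    proof (intro sum.cong refl)
      fix \<alpha> and i :: 'n
      show "a (\<alpha>, i) * basis_form (\<alpha>, i) j z =
          (if i = j then (if \<alpha> \<in> A j then b j \<alpha> * monomial \<alpha> z else 0) else 0)"
        using mono_coeff_pos[of \<alpha>] by (auto simp: a_def basis_form_def monomial_form_def)
    qed
    also have "\<dots> = (\<Sum>\<alpha>\<in>(\<Union>j. A j). if \<alpha> \<in> A j then b j \<alpha> * monomial \<alpha> z else 0)" by simp
    also have "\<dots> = (\<Sum>\<alpha>\<in>A j. b j \<alpha> * monomial \<alpha> z)"
      using A by (intro sum.mono_neutral_cong_right) auto
    finally show ?thesis .
  qed
  then have "form_norm M (\<lambda>j z. F j z - (\<Sum>x\<in>I. a x * basis_form x j z)) \<le>
      (\<Sum>j\<in>UNIV. L2_norm M (\<lambda>z. F j z - (\<Sum>\<alpha>\<in>A j. b j \<alpha> * monomial \<alpha> z)))"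
    using L2_set_le_sum[of UNIV "\<lambda>j. L2_norm M (\<lambda>z. F j z - (\<Sum>\<alpha>\<in>A j. b j \<alpha> * monomial \<alpha> z))"]
    by (simp add: form_norm_def L2_set_def L2_norm_nonneg)
  also have "\<dots> < (\<Sum>j\<in>(UNIV :: 'n set). d)" using b by (intro sum_strict_mono) auto
  also have "\<dots> = e" by (simp add: d_def)
  finally show ?thesis using I by blast
qed

lemma basis_form_orthonormal_basis: "orthonormal_basis M (range basis_form)"
  unfolding orthonormal_basis_def
proof (intro conjI ballI allI impI)
  show "range basis_form \<subseteq> A2_01 M" using basis_form_A2_01 by blast
next
  fix F G assume "F \<in> range basis_form" "G \<in> range basis_form"
  then show "form_inner M F G = (if F = G then 1 else 0)"
    using inj_basis_form by (auto simp: basis_form_inner inj_eq)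
next
  fix F and e :: real assume "F \<in> A2_01 M" "0 < e"
  then obtain I a where I: "finite I" "form_norm M (\<lambda>j z. F j z - (\<Sum>x\<in>I. a x * basis_form x j z)) < e"
    using basis_form_dense by blast
  define a' where "a' = (\<lambda>G. a (inv basis_form G))"
  have "(\<Sum>G\<in>basis_form ` I. a' G * G j z) = (\<Sum>x\<in>I. a x * basis_form x j z)" for j z
    using inj_basis_form by (subst sum.reindex) (auto simp: a'_def inj_on_def inv_f_f inj_def)
  then show "\<exists>B a. finite B \<and> B \<subseteq> range basis_form \<and>
      form_norm M (\<lambda>j z. F j z - (\<Sum>G\<in>B. a G * G j z)) < e"
    using I by (intro exI[of _ "basis_form ` I"] exI[of _ a']) auto
qed

lemma canonical_solution_on_basis_form:
  assumes S: "is_canonical_solution_operator M S"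
  shows "AE z in M. S (basis_form x) z = basis_solution x z"
proof -
  obtain \<alpha> j where x: "x = (\<alpha>, j)" by (cases x)
  let ?c = "complex_of_real (sqrt (mono_coeff M \<alpha>))"
  have "AE z in M. S (monomial_form \<alpha> j) z = solution \<alpha> j z"
    using S by (intro canonical_monomial_solution_unique[OF _ solution_canonical])
      (simp add: is_canonical_solution_operator_def)
  moreover have "AE z in M. S (\<lambda>i z. ?c * monomial_form \<alpha> j i z + 0 * monomial_form \<alpha> j i z) z =
      ?c * S (monomial_form \<alpha> j) z + 0 * S (monomial_form \<alpha> j) z"
    using S scaled_monomial_form_polynomial[of 1 \<alpha> j]
    unfolding is_canonical_solution_operator_def AE_linear_on_def mult_1 by blast
  ultimately show ?thesis
    by eventually_elim (simp add: x basis_form_def basis_solution_def)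
qed

lemma basis_solution_L2: "basis_solution x \<in> L2 M"
  by (auto simp: basis_solution_def intro: L2_scale solution_L2 split: prod.split)

lemma basis_solution_norm:
  "(L2_norm M (basis_solution (\<alpha>, j)))\<^sup>2 = mono_coeff M \<alpha> * (L2_norm M (solution \<alpha> j))\<^sup>2"
  using mono_coeff_pos[of \<alpha>] by (simp add: basis_solution_def L2_norm_scale power_mult_distrib)

definition graded_norm :: "nat \<Rightarrow> real" where
  "graded_norm k = (\<Sum>x\<in>graded k. (L2_norm M (basis_solution x))\<^sup>2)"

lemma graded_norm_nonneg: "0 \<le> graded_norm k"
  by (simp add: graded_norm_def sum_nonneg)

lemma sum_graded_norm: "(\<Sum>k\<le>N. graded_norm k) = (\<Sum>(\<gamma>, p)\<in>graded N. ratio \<gamma> p)"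
  unfolding sum_solution_norms[symmetric] graded_norm_def
  by (intro sum.cong refl) (auto simp: basis_solution_norm)

definition below :: "nat \<Rightarrow> (('n \<Rightarrow> nat) \<times> 'n) set" where
  "below n = (\<Union>k<n. graded k)"

lemma finite_below: "finite (below n)"
  by (simp add: below_def finite_graded)

lemma sum_below: "(\<Sum>x\<in>below n. f x) = (\<Sum>k<n. \<Sum>x\<in>graded k. f x)"
  unfolding below_def using finite_graded graded_disjoint by (intro sum.UNION_disjoint) auto

text \<open>
  Any extension agrees with the explicit solutions on the basis forms. These are orthonormal, so
  the partial sums have a common bound.
\<close>

lemma summable_graded_norm_if_hilbert_schmidt:
  assumes "extends_to_hilbert_schmidt M (canonical_solution_operator M)"
  shows "summable graded_norm"
proof -
  obtain T where T: "hilbert_schmidt M T"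
    and ext: "\<And>F. F \<in> polynomial_forms \<Longrightarrow> AE z in M. T F z = canonical_solution_operator M F z"
    using assms by (auto simp: extends_to_hilbert_schmidt_def)
  have TL: "T F \<in> L2 M" if "F \<in> A2_01 M" for F using T that by (simp add: hilbert_schmidt_def)
  have TB: "L2_norm M (T (basis_form x)) = L2_norm M (basis_solution x)" for x
  proof (rule L2_norm_cong_AE)
    show "AE z in M. T (basis_form x) z = basis_solution x z"
      using ext[OF basis_form_polynomial, of x]
        canonical_solution_on_basis_form[OF canonical_solution_operator_correct, of x]
      by eventually_elim simp
  qed (intro TL basis_form_A2_01 basis_solution_L2)+
  obtain K where K: "\<And>(I :: (('n \<Rightarrow> nat) \<times> 'n) set) g. orthonormal_on I g \<Longrightarrow> (\<Sum>i\<in>I. (L2_norm M (T (g i)))\<^sup>2) \<le> K"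
    using hilbert_schmidt_bounded_on_orthonormal[OF T] by blast
  have "(\<Sum>k\<le>n. graded_norm k) \<le> K" for n
    using K[OF basis_form_orthonormal[OF finite_below[of "Suc n"]]]
    by (simp add: sum_below TB graded_norm_def lessThan_Suc_atMost)
  then show ?thesis using graded_norm_nonneg by (rule bounded_imp_summable[rotated])
qed

section \<open>The operator defined by the orthogonal expansion\<close>

text \<open>
  The square function dominates all expansions simultaneously: its integral is the Hilbert-Schmidt
  series. In particular one null set outside of which everything converges serves all forms.
\<close>

definition square_function :: "nat \<Rightarrow> complex ^ 'n \<Rightarrow> real" where
  "square_function k z = (\<Sum>x\<in>graded k. (cmod (basis_solution x z))\<^sup>2)"

text \<open>
  Grouping by degree makes the terms finite sums, so that an ordinary series is enough. At points
  of divergence the value is arbitrary, and these points form a null set if \<open>graded_norm\<close> is summable.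
\<close>

definition expansion :: "'n form01 \<Rightarrow> 'n cfun" where
  "expansion F z = (\<Sum>k. \<Sum>x\<in>graded k. form_inner M F (basis_form x) * basis_solution x z)"

lemma square_function_nonneg: "0 \<le> square_function k z"
  by (simp add: square_function_def sum_nonneg)

lemma square_function_integrable: "integrable M (square_function k)"
  unfolding square_function_def[abs_def]
  by (intro Bochner_Integration.integrable_sum L2_int basis_solution_L2)

lemma integral_square_function: "(\<integral>z. square_function k z \<partial>M) = graded_norm k"
  unfolding square_function_def graded_norm_def L2_norm_sq
  by (intro Bochner_Integration.integral_sum L2_int basis_solution_L2)

lemma AE_summable_square_function:
  assumes "summable graded_norm"
  shows "AE z in M. summable (\<lambda>k. square_function k z)"
proof -
  note [measurable] = borel_measurable_integrable[OF square_function_integrable]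
  have "(\<integral>\<^sup>+z. (\<Sum>k. ennreal (square_function k z)) \<partial>M) =
      (\<Sum>k. \<integral>\<^sup>+z. ennreal (square_function k z) \<partial>M)"
    by (rule nn_integral_suminf) measurable
  also have "\<dots> = (\<Sum>k. ennreal (graded_norm k))"
    by (simp add: nn_integral_eq_integral square_function_integrable square_function_nonneg
        integral_square_function)
  also have "\<dots> \<noteq> \<infinity>"
    unfolding infinity_ennreal_def by (rule ennreal_suminf_neq_top[OF assms graded_norm_nonneg])
  finally have "AE z in M. (\<Sum>k. ennreal (square_function k z)) \<noteq> \<infinity>"
    by (intro nn_integral_PInf_AE) measurable
  then show ?thesis
    by eventually_elim (auto intro: summable_suminf_not_top square_function_nonneg)
qed

lemma integrable_suminf_square_function:
  assumes "summable graded_norm"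
  shows "integrable M (\<lambda>z. \<Sum>k. square_function k z)"
  using AE_summable_square_function[OF assms] assms
  by (intro integrable_suminf square_function_integrable)
    (simp_all add: square_function_nonneg integral_square_function)

text \<open>
  The Cauchy-Schwarz inequality at the point \<open>z\<close> separates the coefficients, which Bessel's inequality
  bounds by the norm of \<open>F\<close>, from the solutions.
\<close>

lemma expansion_converges:
  assumes F: "F \<in> A2_01 M" and z: "summable (\<lambda>k. square_function k z)"
  shows "summable (\<lambda>k. \<Sum>x\<in>graded k. form_inner M F (basis_form x) * basis_solution x z)"
    and "(cmod (expansion F z))\<^sup>2 \<le> (form_norm M F)\<^sup>2 * (\<Sum>k. square_function k z)"
proof -
  define c where "c = (\<lambda>x. form_inner M F (basis_form x))"
  define u where "u = (\<lambda>k. \<Sum>x\<in>graded k. c x * basis_solution x z)"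
  define Q where "Q = (form_norm M F)\<^sup>2 * (\<Sum>k. square_function k z)"
  have Q: "0 \<le> Q"
    unfolding Q_def using z by (intro mult_nonneg_nonneg suminf_nonneg square_function_nonneg) auto
  have b: "(\<Sum>k<n. norm (u k)) \<le> sqrt Q" for n
  proof (rule real_le_rsqrt)
    have "(\<Sum>k<n. norm (u k)) \<le> (\<Sum>k<n. \<Sum>x\<in>graded k. cmod (c x) * cmod (basis_solution x z))"
      unfolding u_def by (intro sum_mono sum_norm_le) (simp add: norm_mult)
    then have "(\<Sum>k<n. norm (u k))\<^sup>2 \<le> (\<Sum>x\<in>below n. cmod (c x) * cmod (basis_solution x z))\<^sup>2"
      unfolding sum_below by (intro power_mono sum_nonneg norm_ge_zero)
    also have "\<dots> \<le> (\<Sum>x\<in>below n. (cmod (c x))\<^sup>2) * (\<Sum>x\<in>below n. (cmod (basis_solution x z))\<^sup>2)"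
      by (rule Cauchy_Schwarz_ineq_sum)
    also have "\<dots> \<le> (form_norm M F)\<^sup>2 * (\<Sum>k. square_function k z)"
    proof (rule mult_mono)
      show "(\<Sum>x\<in>below n. (cmod (c x))\<^sup>2) \<le> (form_norm M F)\<^sup>2"
        unfolding c_def by (intro Bessel basis_form_orthonormal finite_below F)
      have "(\<Sum>x\<in>below n. (cmod (basis_solution x z))\<^sup>2) = (\<Sum>k<n. square_function k z)"
        by (simp add: sum_below square_function_def)
      also have "\<dots> \<le> (\<Sum>k. square_function k z)"
        using z by (intro sum_le_suminf) (auto simp: square_function_nonneg)
      finally show "(\<Sum>x\<in>below n. (cmod (basis_solution x z))\<^sup>2) \<le> (\<Sum>k. square_function k z)" .
    qed (auto intro: sum_nonneg)
    finally show "(\<Sum>k<n. norm (u k))\<^sup>2 \<le> Q" by (simp add: Q_def)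
  qed
  have s: "summable (\<lambda>k. norm (u k))"
    using b[of "Suc n" for n] by (intro bounded_imp_summable[of _ "sqrt Q"]) (auto simp: lessThan_Suc_atMost)
  then show "summable (\<lambda>k. \<Sum>x\<in>graded k. form_inner M F (basis_form x) * basis_solution x z)"
    unfolding u_def c_def by (rule summable_norm_cancel)
  have "cmod (suminf u) \<le> (\<Sum>k. norm (u k))" by (rule summable_norm[OF s])
  also have "\<dots> \<le> sqrt Q" using s b by (rule suminf_le_const)
  finally have "(cmod (suminf u))\<^sup>2 \<le> (sqrt Q)\<^sup>2" by (intro power_mono) auto
  then show "(cmod (expansion F z))\<^sup>2 \<le> (form_norm M F)\<^sup>2 * (\<Sum>k. square_function k z)"
    using Q by (simp add: expansion_def u_def c_def Q_def)
qed

lemma expansion_measurable: "expansion F \<in> borel_measurable M"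
proof -
  note [measurable] = L2_meas[OF basis_solution_L2]
  show ?thesis unfolding expansion_def[abs_def] by measurable
qed

lemma expansion_L2:
  assumes h: "summable graded_norm" and F: "F \<in> A2_01 M"
  shows "expansion F \<in> L2 M"
    and "L2_norm M (expansion F) \<le> sqrt (\<integral>z. (\<Sum>k. square_function k z) \<partial>M) * form_norm M F"
proof -
  note [measurable] = expansion_measurable
  let ?h = "\<lambda>z. (form_norm M F)\<^sup>2 * (\<Sum>k. square_function k z)"
  have hI: "integrable M ?h" using integrable_suminf_square_function[OF h] by simp
  have le: "AE z in M. (cmod (expansion F z))\<^sup>2 \<le> ?h z"
    using AE_summable_square_function[OF h] by eventually_elim (rule expansion_converges(2)[OF F])
  have I: "integrable M (\<lambda>z. (cmod (expansion F z))\<^sup>2)"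
    using le by (intro Bochner_Integration.integrable_bound[OF hI]) (auto elim: eventually_mono)
  then show "expansion F \<in> L2 M" by (simp add: L2_def)
  have "(\<integral>z. (cmod (expansion F z))\<^sup>2 \<partial>M) \<le> (\<integral>z. ?h z \<partial>M)"
    using I hI le by (rule integral_mono_AE)
  also have "\<dots> = (form_norm M F)\<^sup>2 * (\<integral>z. (\<Sum>k. square_function k z) \<partial>M)" by simp
  finally have "L2_norm M (expansion F) \<le> sqrt ((form_norm M F)\<^sup>2 * (\<integral>z. (\<Sum>k. square_function k z) \<partial>M))"
    unfolding L2_norm_def by (rule real_sqrt_le_mono)
  then show "L2_norm M (expansion F) \<le> sqrt (\<integral>z. (\<Sum>k. square_function k z) \<partial>M) * form_norm M F"
    by (simp add: real_sqrt_mult form_norm_nonneg mult.commute)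
qed

lemma expansion_linear:
  assumes h: "summable graded_norm"
  shows "AE_linear_on M (A2_01 M) expansion"
  unfolding AE_linear_on_def
proof (intro ballI allI)
  fix F G :: "'n form01" and a b :: complex
  assume F: "F \<in> A2_01 M" and G: "G \<in> A2_01 M"
  show "AE z in M. expansion (\<lambda>j w. a * F j w + b * G j w) z = a * expansion F z + b * expansion G z"
    using AE_summable_square_function[OF h]
  proof eventually_elim
    case (elim z)
    note sF = expansion_converges(1)[OF F elim] and sG = expansion_converges(1)[OF G elim]
    show ?case
      unfolding expansion_def suminf_mult[OF sF, symmetric] suminf_mult[OF sG, symmetric]
        suminf_add[OF summable_mult[OF sF] summable_mult[OF sG]]
      by (simp add: form_inner_lincomb_left[OF F G basis_form_A2_01] sum_distrib_left
          sum.distrib[symmetric] algebra_simps)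
  qed
qed

lemma expansion_scaled_basis_form:
  "expansion (\<lambda>i w. a * basis_form x i w) z = a * basis_solution x z"
proof -
  obtain \<alpha> j where x: "x = (\<alpha>, j)" by (cases x)
  define n where "n = (\<Sum>j\<in>UNIV. \<alpha> j)"
  have inner: "form_inner M (\<lambda>i w. a * basis_form x i w) (basis_form y) = (if y = x then a else 0)" for y
  proof -
    have "form_inner M (\<lambda>i w. a * basis_form x i w) (basis_form y) =
        a * form_inner M (basis_form x) (basis_form y)"
      unfolding form_inner_def by (simp add: inner_scale_left sum_distrib_left)
    then show ?thesis by (simp add: basis_form_inner)
  qed
  have component: "(\<Sum>y\<in>graded k. form_inner M (\<lambda>i w. a * basis_form x i w) (basis_form y) * basis_solution y z) =
      (if k = n then a * basis_solution x z else 0)" for k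
  proof -
    have "(\<Sum>y\<in>graded k. form_inner M (\<lambda>i w. a * basis_form x i w) (basis_form y) * basis_solution y z) =
        (\<Sum>y\<in>graded k. if y = x then a * basis_solution x z else 0)"
      by (intro sum.cong) (auto simp: inner)
    also have "\<dots> = (if x \<in> graded k then a * basis_solution x z else 0)"
      by (simp add: finite_graded)
    also have "x \<in> graded k \<longleftrightarrow> k = n" by (auto simp: x n_def graded_def)
    finally show ?thesis .
  qed
  have "(\<lambda>k. if k = n then a * basis_solution x z else 0) sums (a * basis_solution x z)"
    by (rule sums_single)
  then show ?thesis unfolding expansion_def component by (rule sums_unique[symmetric])
qed

lemma expansion_basis_form: "expansion (basis_form x) = basis_solution x"
  using expansion_scaled_basis_form[of 1 x] by (simp add: fun_eq_iff)

text \<open>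
  Since the canonical solution operator is determined almost everywhere by its values on monomial
  forms, this shows that \<open>expansion\<close> extends it.
\<close>

lemma expansion_canonical:
  assumes h: "summable graded_norm"
  shows "is_canonical_solution_operator M expansion"
  unfolding is_canonical_solution_operator_def
proof (intro conjI ballI allI)
  show "expansion F \<in> L2 M" if "F \<in> polynomial_forms" for F
    using expansion_L2(1)[OF h polynomial_forms_A2_01[OF that]] .
  show "AE_linear_on M polynomial_forms expansion"
    using expansion_linear[OF h] polynomial_forms_A2_01 unfolding AE_linear_on_def by blast
  show "canonical_monomial_solution M \<alpha> j (expansion (monomial_form \<alpha> j))" for \<alpha> j
  proof -
    let ?c = "complex_of_real (sqrt (mono_coeff M \<alpha>))"
    have c: "?c \<noteq> 0" using mono_coeff_pos[of \<alpha>] by simp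
    then have "monomial_form \<alpha> j = (\<lambda>i w. inverse ?c * basis_form (\<alpha>, j) i w)"
      by (simp add: basis_form_def fun_eq_iff)
    then have "expansion (monomial_form \<alpha> j) = (\<lambda>z. inverse ?c * basis_solution (\<alpha>, j) z)"
      by (simp only: expansion_scaled_basis_form[abs_def])
    also have "\<dots> = solution \<alpha> j"
      using c by (simp add: basis_solution_def fun_eq_iff)
    finally have "expansion (monomial_form \<alpha> j) = solution \<alpha> j" .
    then show ?thesis using solution_canonical by simp
  qed
qed

lemma hilbert_schmidt_expansion:
  assumes h: "summable graded_norm"
  shows "hilbert_schmidt M expansion"
  unfolding hilbert_schmidt_def
proof (intro conjI exI ballI)
  show "orthonormal_basis M (range basis_form)" by (rule basis_form_orthonormal_basis)
  have "(\<lambda>x. (L2_norm M (basis_solution x))\<^sup>2) summable_on UNIV"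
  proof (rule nonneg_bdd_above_summable_on)
    have "(\<Sum>x\<in>I. (L2_norm M (basis_solution x))\<^sup>2) \<le> suminf graded_norm" if "finite I" for I
    proof -
      define n where "n = Suc (Max ((\<lambda>(\<alpha>, j). \<Sum>j\<in>UNIV. \<alpha> j) ` I))"
      have "I \<subseteq> below n"
      proof
        fix x assume x: "x \<in> I"
        then have "(case x of (\<alpha>, j) \<Rightarrow> \<Sum>j\<in>UNIV. \<alpha> j) < n"
          unfolding n_def using that by (intro le_imp_less_Suc Max_ge) auto
        then show "x \<in> below n" by (auto simp: below_def graded_def split: prod.splits)
      qed
      then have "(\<Sum>x\<in>I. (L2_norm M (basis_solution x))\<^sup>2) \<le> (\<Sum>x\<in>below n. (L2_norm M (basis_solution x))\<^sup>2)"
        by (intro sum_mono2 finite_below) auto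
      also have "\<dots> = (\<Sum>k<n. graded_norm k)" by (simp add: sum_below graded_norm_def)
      also have "\<dots> \<le> suminf graded_norm"
        using h graded_norm_nonneg by (intro sum_le_suminf) auto
      finally show ?thesis .
    qed
    then show "bdd_above (sum (\<lambda>x. (L2_norm M (basis_solution x))\<^sup>2) ` {I. I \<subseteq> UNIV \<and> finite I})"
      by (intro bdd_aboveI[of _ "suminf graded_norm"]) auto
  qed simp
  then show "(\<lambda>F. (L2_norm M (expansion F))\<^sup>2) summable_on range basis_form"
    using inj_basis_form by (subst summable_on_reindex) (simp_all add: o_def expansion_basis_form)
qed (use expansion_L2[OF h] expansion_linear[OF h] in blast)+

lemma extends_to_hilbert_schmidt_iff:
  "extends_to_hilbert_schmidt M (canonical_solution_operator M) \<longleftrightarrow> summable graded_norm"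
proof
  assume h: "summable graded_norm"
  have "AE z in M. expansion F z = canonical_solution_operator M F z" if "F \<in> polynomial_forms" for F
    using expansion_canonical[OF h] canonical_solution_operator_correct that
    by (rule canonical_solution_operator_unique)
  then show "extends_to_hilbert_schmidt M (canonical_solution_operator M)"
    unfolding extends_to_hilbert_schmidt_def using hilbert_schmidt_expansion[OF h] by blast
qed (rule summable_graded_norm_if_hilbert_schmidt)

end

theorem theorem4:
  fixes M :: "(complex ^ 'n::finite) measure"
  assumes "sets M = sets borel"
    and "\<And>\<alpha>. integrable M (\<lambda>z. (cmod (monomial \<alpha> z))\<^sup>2)"
    and "\<And>\<alpha>. 0 < (\<integral>z. (cmod (monomial \<alpha> z))\<^sup>2 \<partial>M)"
    and "\<And>\<alpha> \<beta>. \<alpha> \<noteq> \<beta> \<Longrightarrow> L2_inner M (monomial \<alpha>) (monomial \<beta>) = 0"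
  shows "extends_to_hilbert_schmidt M (canonical_solution_operator M) \<longleftrightarrow>
    convergent (\<lambda>k. \<Sum>(\<gamma>, p) \<in> {\<gamma> :: 'n \<Rightarrow> nat. (\<Sum>j\<in>UNIV. \<gamma> j) = k} \<times> (UNIV :: 'n set).
      mono_coeff M \<gamma> / mono_coeff M (\<lambda>q. \<gamma> q + unit_index p q))"
proof -
  interpret orthogonal_monomials M
    using assms by unfold_locales
  show ?thesis
    unfolding extends_to_hilbert_schmidt_iff summable_iff_convergent' sum_graded_norm
    by (simp only: graded_def ratio_def[abs_def])
qed

end
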